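(* Let $n\ge3$, $0<\lambda\le\Lambda$, let $g:[0,\infty)\to[0,\infty)$ be continuous, put $G(t)=\int_0^t g(\tau)\,d\tau$ and $\varphi_g(s)=\int_0^s e^{G(t)}\,dt$, and for $p>1$ let $f(t)=\varphi_g(t)^{p}e^{-G(t)}$, $t\ge0$. Let $\widetilde N_+=\frac{\lambda}{\Lambda}(n-1)+1$, $\widetilde N_-=\frac{\Lambda}{\lambda}(n-1)+1$. (a) If $\widetilde N_+>2$ and $1<p\le p^s_+:=\frac{\widetilde N_+}{\widetilde N_+-2}$, then the equation $$\mathcal{M}^{+}_{\lambda,\Lambda}\big(D^2u+g(u)\nabla u\otimes\nabla u\big)+f(u)=0,\quad u\ge0\quad\text{in }\mathbb{R}^n$$ does not admit a non-trivial solution. (b) If $1<p\le p^s_-:=\frac{\widetilde N_-}{\widetilde N_--2}$, then the equation $$\mathcal{M}^{-}_{\lambda,\Lambda}\big(D^2u+g(u)\nabla u\otimes\nabla u\big)+f(u)=0,\quad u\ge0\quad\text{in }\mathbb{R}^n$$ has no non-trivial solution.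
   Context: For a symmetric $n\times n$ matrix $M$ with eigenvalues $e_1,\dots,e_n$, the Pucci operators are $\mathcal{M}^{+}_{\lambda,\Lambda}(M)=\Lambda\sum_{e_i>0}e_i+\lambda\sum_{e_i<0}e_i$ and $\mathcal{M}^{-}_{\lambda,\Lambda}(M)=\lambda\sum_{e_i>0}e_i+\Lambda\sum_{e_i<0}e_i$. $D^2u$ is the Hessian matrix of $u$, and $\xi\otimes\xi$ is the matrix $(\xi_i\xi_j)$. Solutions are classical ($u\in C^2(\mathbb{R}^n)$, $u\ge0$); the trivial solution is $u\equiv0$. *)

theory Defs
  imports
    "HOL-Analysis.Analysis"
    "HOL-Computational_Algebra.Computational_Algebra"
begin

definition char_polynomial :: "real^'n^'n \<Rightarrow> real poly" where
  "char_polynomial M = det (mat [:0, 1:] - map_matrix (\<lambda>a. [:a:]) M)"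

text \<open>Real eigenvalues with algebraic multiplicity. For a symmetric matrix this multiset has
  CARD('n) elements; no condition of symmetry is built in, but the operators below are only
  applied to symmetric matrices.\<close>

definition eigenvalues :: "real^'n^'n \<Rightarrow> real multiset" where
  "eigenvalues M = proots (char_polynomial M)"

definition pucci_plus :: "real \<Rightarrow> real \<Rightarrow> real^'n^'n \<Rightarrow> real" where
  "pucci_plus lam Lam M =
     Lam * \<Sum>\<^sub># (filter_mset (\<lambda>e. e > 0) (eigenvalues M))
     + lam * \<Sum>\<^sub># (filter_mset (\<lambda>e. e < 0) (eigenvalues M))"

definition pucci_minus :: "real \<Rightarrow> real \<Rightarrow> real^'n^'n \<Rightarrow> real" where
  "pucci_minus lam Lam M =
     lam * \<Sum>\<^sub># (filter_mset (\<lambda>e. e > 0) (eigenvalues M))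
     + Lam * \<Sum>\<^sub># (filter_mset (\<lambda>e. e < 0) (eigenvalues M))"

text \<open>Only meaningful where \<open>u\<close> is differentiable, which \<open>C1\<close> and \<open>C2\<close> below require
  before any continuity of partial derivatives is demanded.\<close>

definition partial :: "'n \<Rightarrow> (real^'n \<Rightarrow> real) \<Rightarrow> real^'n \<Rightarrow> real" where
  "partial i u x = frechet_derivative u (at x) (axis i 1)"

definition C1 :: "(real^'n \<Rightarrow> real) \<Rightarrow> bool" where
  "C1 u \<longleftrightarrow> (\<forall>x. u differentiable (at x)) \<and> (\<forall>i. continuous_on UNIV (partial i u))"

definition C2 :: "(real^'n \<Rightarrow> real) \<Rightarrow> bool" where
  "C2 u \<longleftrightarrow> C1 u \<and> (\<forall>i. C1 (partial i u))"

definition grad :: "(real^'n \<Rightarrow> real) \<Rightarrow> real^'n \<Rightarrow> real^'n" where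
  "grad u x = (\<chi> i. partial i u x)"

definition hessian :: "(real^'n \<Rightarrow> real) \<Rightarrow> real^'n \<Rightarrow> real^'n^'n" where
  "hessian u x = (\<chi> i j. partial i (partial j u) x)"

definition tensor_square :: "real^'n \<Rightarrow> real^'n^'n" where
  "tensor_square \<xi> = (\<chi> i j. \<xi> $ i * \<xi> $ j)"

definition primitive :: "(real \<Rightarrow> real) \<Rightarrow> real \<Rightarrow> real" where
  "primitive g t = integral {0..t} g"

definition phi :: "(real \<Rightarrow> real) \<Rightarrow> real \<Rightarrow> real" where
  "phi g s = integral {0..s} (\<lambda>t. exp (primitive g t))"

definition nonlinearity :: "(real \<Rightarrow> real) \<Rightarrow> real \<Rightarrow> real \<Rightarrow> real" where
  "nonlinearity g p t = phi g t powr p * exp (- primitive g t)"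

text \<open>Classical solutions of \<open>F(D\<^sup>2u + g(u) \<nabla>u \<otimes> \<nabla>u) + f(u) = 0\<close>, \<open>u \<ge> 0\<close>, on the whole space.
  Since \<open>u \<ge> 0\<close>, only the values of \<open>g\<close> and \<open>f\<close> on \<open>[0,\<infinity>)\<close> matter.\<close>

definition classical_solution ::
  "(real^'n^'n \<Rightarrow> real) \<Rightarrow> (real \<Rightarrow> real) \<Rightarrow> (real \<Rightarrow> real) \<Rightarrow> (real^'n \<Rightarrow> real) \<Rightarrow> bool" where
  "classical_solution F g f u \<longleftrightarrow> C2 u \<and> (\<forall>x. u x \<ge> 0) \<and>
     (\<forall>x. F (hessian u x + g (u x) *\<^sub>R tensor_square (grad u x)) + f (u x) = 0)"

definition dim_plus :: "real \<Rightarrow> real \<Rightarrow> nat \<Rightarrow> real" where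
  "dim_plus lam Lam n = lam / Lam * (real n - 1) + 1"

definition dim_minus :: "real \<Rightarrow> real \<Rightarrow> nat \<Rightarrow> real" where
  "dim_minus lam Lam n = Lam / lam * (real n - 1) + 1"

end

theory Submission
  imports Defs "HOL-Real_Asymp.Real_Asymp"
begin

text \<open>The function \<open>v = \<phi>\<^sub>g (u)\<close> satisfies \<open>M (D\<^sup>2v) = - v\<^sup>p\<close>, without a gradient term. Everything that is
  used about \<open>v\<close> comes from radial functions touching it from below. Let \<open>\<alpha>\<close> be the effective
  dimension minus 2, so that \<open>r\<^sup>-\<^sup>\<alpha>\<close> is the radial fundamental solution. If \<open>v\<close> is not zero, comparison
  with slightly perturbed fundamental solutions gives \<open>v \<ge> c r\<^sup>-\<^sup>\<alpha>\<close>. For \<open>p \<le> (\<alpha> + 2) / \<alpha>\<close> this makes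
  the source \<open>v\<^sup>p\<close> at least of order \<open>r\<^sup>-\<^sup>\<alpha>\<^sup>-\<^sup>2\<close>, and a second comparison gives
  \<open>v \<ge> \<epsilon> r\<^sup>-\<^sup>\<alpha> ln r\<close>. On the other hand, sliding a bump supported in a ball of radius \<open>R\<close> under \<open>v\<close>
  yields a point of the ball with \<open>v\<^sup>p\<^sup>-\<^sup>1 \<le> C R\<^sup>-\<^sup>2\<close>; since \<open>\<alpha> (p - 1) \<le> 2\<close>, the logarithm
  contradicts this for large \<open>R\<close>.\<close>

no_notation fps_nth (infixl "$" 75)

subsection \<open>Pucci operators in an orthonormal eigenbasis\<close>

text \<open>A maximizer \<open>q\<close> of the Rayleigh quotient on the unit sphere of
  \<open>S\<close> is an eigenvector: moving it along the residual \<open>h = f q - e q\<close>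
  would raise the quotient to first order unless \<open>h = 0\<close>.\<close>

lemma symmetric_map_eigenvector:
  fixes f :: "'a::euclidean_space \<Rightarrow> 'a"
  assumes "linear f" and sym: "\<And>x y. f x \<bullet> y = x \<bullet> f y"
    and S: "subspace S" "S \<noteq> {0}" and inv: "\<And>x. x \<in> S \<Longrightarrow> f x \<in> S"
  obtains q e where "q \<in> S" "norm q = 1" "f q = e *\<^sub>R q"
proof -
  interpret linear f by fact
  define K where "K = S \<inter> sphere 0 1"
  have "compact K"
    unfolding K_def using closed_subspace[OF S(1)] by (simp add: closed_Int_compact)
  moreover have "K \<noteq> {}"
  proof -
    obtain x where x: "x \<in> S" "x \<noteq> 0" using S subspace_0 by blast
    then have "x /\<^sub>R norm x \<in> K"
      using S(1) by (simp add: K_def subspace_scale)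
    then show ?thesis by blast
  qed
  moreover have "continuous_on K (\<lambda>x. x \<bullet> f x)"
    using \<open>linear f\<close> by (intro continuous_intros linear_continuous_on)
      (simp add: linear_conv_bounded_linear)
  ultimately obtain q where q: "q \<in> K" and qmax: "\<And>x. x \<in> K \<Longrightarrow> x \<bullet> f x \<le> q \<bullet> f q"
    using continuous_attains_sup[of K "\<lambda>x. x \<bullet> f x"] by blast
  define e where "e = q \<bullet> f q"
  have le: "x \<bullet> f x \<le> e * (x \<bullet> x)" if "x \<in> S" for x
  proof (cases "x = 0")
    case False
    have "x /\<^sub>R norm x \<in> K" using S(1) that False by (simp add: K_def subspace_scale)
    from qmax[OF this] have "(x \<bullet> f x) / (norm x)\<^sup>2 \<le> e"
      by (simp add: e_def scale power2_eq_square divide_inverse mult_ac)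
    then show ?thesis using False
      by (simp add: dot_square_norm divide_le_eq)
  qed (simp add: zero)
  define h where "h = f q - e *\<^sub>R q"
  have qS: "q \<in> S" and nq: "norm q = 1" using q by (auto simp: K_def)
  have hS: "h \<in> S" unfolding h_def using S(1) qS inv by (simp add: subspace_diff subspace_scale)
  define C where "C = e * (h \<bullet> h) - h \<bullet> f h"
  have qq: "q \<bullet> q = 1" using nq by (simp add: dot_square_norm)
  \<comment> \<open>In the maximality inequality at \<open>q + t h\<close> the terms of order zero
    and those with \<open>h \<bullet> q\<close> cancel. Dividing the rest by \<open>t\<close> leaves
    a bound that tends to 0 with \<open>t\<close>.\<close>
  have C: "2 * (h \<bullet> h) \<le> t * C" if "t > 0" for t
  proof -
    have "q + t *\<^sub>R h \<in> S" using S(1) qS hS by (simp add: subspace_add subspace_scale)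
    from le[OF this] have "(q + t *\<^sub>R h) \<bullet> f (q + t *\<^sub>R h) \<le> e * ((q + t *\<^sub>R h) \<bullet> (q + t *\<^sub>R h))" .
    moreover have "f (q + t *\<^sub>R h) = f q + t *\<^sub>R f h" by (simp add: add scale)
    moreover have "q \<bullet> f h = h \<bullet> f q" using sym[of q h] by (simp add: inner_commute)
    moreover have "h \<bullet> f q = h \<bullet> h + e * (h \<bullet> q)"
      by (simp add: h_def inner_diff_right inner_diff_left algebra_simps)
    ultimately have "e + 2 * t * (h \<bullet> h + e * (h \<bullet> q)) + t * t * (h \<bullet> f h)
        \<le> e * (1 + 2 * t * (h \<bullet> q) + t * t * (h \<bullet> h))"
      by (simp add: inner_add_left inner_add_right qq e_def[symmetric] inner_commute[of q h] algebra_simps)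
    then have "t * (2 * (h \<bullet> h)) \<le> t * (t * C)"
      by (simp add: C_def algebra_simps)
    then show ?thesis using that by simp
  qed
  have "h = 0"
  proof (rule ccontr)
    assume "h \<noteq> 0"
    then have pos: "h \<bullet> h > 0" by simp
    have "C > 0" using C[of 1] pos by linarith
    with C[of "(h \<bullet> h) / C"] pos show False by simp
  qed
  then have "f q = e *\<^sub>R q" by (simp add: h_def)
  with qS nq show ?thesis by (rule that)
qed

text \<open>Induction on the dimension: by symmetry the orthogonal complement of an eigenvector
  inside \<open>S\<close> is again invariant.\<close>

lemma symmetric_map_orthonormal_eigenbasis:
  fixes f :: "'a::euclidean_space \<Rightarrow> 'a"
  assumes "linear f" and sym: "\<And>x y. f x \<bullet> y = x \<bullet> f y"
  shows "subspace S \<Longrightarrow> (\<And>x. x \<in> S \<Longrightarrow> f x \<in> S) \<Longrightarrow>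
    \<exists>B. B \<subseteq> S \<and> pairwise orthogonal B \<and> (\<forall>b\<in>B. norm b = 1 \<and> (\<exists>e. f b = e *\<^sub>R b)) \<and> span B = S"
proof (induction "dim S" arbitrary: S rule: less_induct)
  case less
  show ?case
  proof (cases "S = {0}")
    case True
    then show ?thesis by (intro exI[of _ "{}"]) auto
  next
    case False
    obtain q e where q: "q \<in> S" "norm q = 1" "f q = e *\<^sub>R q"
      using symmetric_map_eigenvector[OF assms less.prems(1) False less.prems(2)] .
    have qq: "q \<bullet> q = 1" using q(2) by (simp add: dot_square_norm)
    define T where "T = {x \<in> S. q \<bullet> x = 0}"
    have T: "subspace T"
      unfolding T_def using less.prems(1)
      by (auto simp: subspace_def inner_add_right)
    have "T \<subset> S" using q(1) qq by (force simp: T_def)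
    then have "dim T < dim S"
      using T less.prems(1) by (intro dim_psubset) (simp add: span_eq_iff[THEN iffD2])
    moreover have "f x \<in> T" if "x \<in> T" for x
      using that less.prems(2) sym[of q x] q(3) by (auto simp: T_def)
    ultimately obtain B where B: "B \<subseteq> T" "pairwise orthogonal B"
        "\<forall>b\<in>B. norm b = 1 \<and> (\<exists>e. f b = e *\<^sub>R b)" "span B = T"
      using less.hyps[OF _ T] by blast
    have orth: "pairwise orthogonal (insert q B)"
      using B(1,2) by (auto simp: pairwise_insert orthogonal_def T_def inner_commute)
    have "span (insert q B) = S"
    proof
      show "span (insert q B) \<subseteq> S"
        using less.prems(1) q(1) B(1) by (intro span_minimal) (auto simp: T_def)
      show "S \<subseteq> span (insert q B)"
      proof
        fix x assume x: "x \<in> S"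
        have "x - (q \<bullet> x) *\<^sub>R q \<in> T"
          using x q(1) less.prems(1) by (simp add: T_def subspace_diff subspace_scale inner_diff_right qq)
        then show "x \<in> span (insert q B)"
          using B(4) unfolding span_insert by blast
      qed
    qed
    then show ?thesis
      using B orth q by (intro exI[of _ "insert q B"]) (auto simp: T_def)
  qed
qed

lemma symmetric_matrix_eigenbasis:
  fixes M :: "real^'n^'n"
  assumes "transpose M = M"
  obtains q :: "'n \<Rightarrow> real^'n" and e
  where "\<And>i j. q i \<bullet> q j = (if i = j then 1 else 0)" "\<And>i. M *v q i = e i *\<^sub>R q i"
proof -
  have "(M *v x) \<bullet> y = x \<bullet> (M *v y)" for x y
    using dot_lmul_matrix[of x M y] assms by (metis transpose_matrix_vector)
  then have "\<exists>B. B \<subseteq> UNIV \<and> pairwise orthogonal B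
      \<and> (\<forall>b\<in>B. norm b = 1 \<and> (\<exists>e. M *v b = e *\<^sub>R b)) \<and> span B = (UNIV :: (real^'n) set)"
    by (intro symmetric_map_orthonormal_eigenbasis) auto
  then obtain B :: "(real^'n) set" where B: "pairwise orthogonal B"
      "\<forall>b\<in>B. norm b = 1 \<and> (\<exists>e. M *v b = e *\<^sub>R b)" "span B = UNIV" by blast
  have "0 \<notin> B" using B(2) by force
  with B(1) have ind: "independent B" by (rule pairwise_orthogonal_independent)
  then have fin: "finite B" by (rule independent_imp_finite)
  have "card B = CARD('n)"
    using dim_eq_card_independent[OF ind] dim_span[of B] B(3) by (simp add: dim_UNIV)
  then obtain q :: "'n \<Rightarrow> real^'n" where q: "bij_betw q UNIV B"
    using finite_same_card_bij[OF finite fin, of UNIV] by auto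
  then have qB: "q i \<in> B" for i by (auto simp: bij_betw_def)
  then have "\<forall>i. \<exists>e. M *v q i = e *\<^sub>R q i" using B(2) by blast
  from choice[OF this] obtain e where e: "\<And>i. M *v q i = e i *\<^sub>R q i" by blast
  have "q i \<bullet> q j = (if i = j then 1 else 0)" for i j
  proof (cases "i = j")
    case True
    then show ?thesis using B(2) qB[of i] by (simp add: dot_square_norm)
  next
    case False
    then have "q i \<noteq> q j" using q by (auto simp: bij_betw_def inj_def)
    then show ?thesis using B(1) qB False by (auto simp: pairwise_def orthogonal_def)
  qed
  with e show ?thesis by (rule that[rotated])
qed

section \<open>Eigenvalue multisets and quadratic forms in an eigenbasis\<close>

lemma poly_char_polynomial:
  fixes M :: "real^'n^'n"
  shows "poly (char_polynomial M) x = det (mat x - M)"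
proof -
  have "poly ((mat [:0, 1:] - map_matrix (\<lambda>a. [:a:]) M) $ i $ j) x = (mat x - M) $ i $ j" for i j
    by (simp add: mat_def map_matrix_def)
  then show ?thesis
    unfolding char_polynomial_def det_def by (simp add: poly_sum poly_prod del: vector_minus_component)
qed

context
  fixes M :: "real^'n^'n" and q :: "'n \<Rightarrow> real^'n" and e :: "'n \<Rightarrow> real"
  assumes orthonormal: "\<And>i j. q i \<bullet> q j = (if i = j then 1 else 0)"
    and eigen: "\<And>i. M *v q i = e i *\<^sub>R q i"
begin


definition eigenbasis_matrix :: "real^'n^'n" where "eigenbasis_matrix = (\<chi> i j. q j $ i)"

lemma transpose_eigenbasis_matrix: "transpose eigenbasis_matrix ** eigenbasis_matrix = mat 1"
  using orthonormal
  by (simp add: eigenbasis_matrix_def matrix_matrix_mult_def transpose_def mat_def vec_eq_iff inner_vec_def)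

text \<open>With the eigenvectors as columns of Q, \<open>(x - M) Q = Q D\<close> with
  \<open>D\<close> diagonal. Cancelling the nonzero determinant of Q factors the characteristic
  polynomial at every real point, hence as a polynomial, so multiplicities are right as
  well.\<close>

lemma eigenvalues_eigenbasis: "eigenvalues M = image_mset e (mset_set UNIV)"
proof -
  let ?Q = eigenbasis_matrix
  have "det ?Q \<noteq> 0"
    using arg_cong[OF transpose_eigenbasis_matrix, of det] by (auto simp: det_mul)
  have det: "det (mat x - M) = (\<Prod>i\<in>UNIV. x - e i)" for x
  proof -
    define D :: "real^'n^'n" where "D = (\<chi> i j. if i = j then x - e i else 0)"
    have "(\<Sum>k\<in>UNIV. M $ i $ k * q j $ k) = e j * q j $ i" for i j
      using arg_cong[OF eigen[of j], of "\<lambda>v. v $ i"] by (simp add: matrix_vector_mult_def)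
    then have "M ** ?Q = (\<chi> i j. e j * q j $ i)"
      by (simp add: matrix_matrix_mult_def vec_eq_iff eigenbasis_matrix_def)
    moreover have "mat x ** ?Q = (\<chi> i j. x * q j $ i)" "?Q ** D = (\<chi> i j. (x - e j) * q j $ i)"
      by (simp_all add: matrix_matrix_mult_def vec_eq_iff eigenbasis_matrix_def mat_def D_def
        if_distrib if_distribR sum.delta sum.delta' mult.commute cong: if_cong)
    ultimately have "(mat x - M) ** ?Q = ?Q ** D"
      by (simp add: matrix_matrix_mult_def vec_eq_iff left_diff_distrib sum_subtractf)
    then have "det (mat x - M) * det ?Q = det ?Q * det D"
      using det_mul by metis
    moreover have "det D = (\<Prod>i\<in>UNIV. x - e i)"
      by (simp add: det_diagonal D_def)
    ultimately show ?thesis using \<open>det ?Q \<noteq> 0\<close> by simp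
  qed
  have "poly (char_polynomial M) = poly (\<Prod>i\<in>UNIV. [:- e i, 1:])"
    by (simp add: fun_eq_iff poly_char_polynomial det poly_prod)
  then have "char_polynomial M = (\<Prod>i\<in>UNIV. [:- e i, 1:])"
    by (simp only: poly_eq_poly_eq_iff)
  then show ?thesis
    by (simp add: eigenvalues_def proots_prod sum_unfold_sum_mset)
qed

lemma pucci_plus_eigenbasis:
  "pucci_plus lam Lam M = (\<Sum>i\<in>UNIV. (if e i > 0 then Lam else lam) * e i)"
proof -
  have "\<Sum>\<^sub># (filter_mset P (image_mset e (mset_set UNIV))) = (\<Sum>i\<in>UNIV. if P (e i) then e i else 0)" for P
    by (simp add: filter_mset_image_mset sum_unfold_sum_mset[symmetric] sum.If_cases)
  then show ?thesis
    by (simp add: pucci_plus_def eigenvalues_eigenbasis sum_distrib_left flip: sum.distrib)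
      (auto intro!: sum.cong)
qed

lemma pucci_minus_eigenbasis:
  "pucci_minus lam Lam M = (\<Sum>i\<in>UNIV. (if e i > 0 then lam else Lam) * e i)"
  using pucci_plus_eigenbasis[of Lam lam] by (simp add: pucci_plus_def pucci_minus_def)

lemma eigenbasis_expansion: "x = (\<Sum>i\<in>UNIV. (q i \<bullet> x) *\<^sub>R q i)"
proof -
  let ?Q = eigenbasis_matrix
  have "?Q ** transpose ?Q = mat 1"
    using transpose_eigenbasis_matrix matrix_left_right_inverse by blast
  then have "?Q *v (transpose ?Q *v x) = x"
    by (simp only: matrix_vector_mul_assoc matrix_vector_mul_lid)
  moreover have "?Q *v (transpose ?Q *v x) = (\<Sum>i\<in>UNIV. (q i \<bullet> x) *\<^sub>R q i)"
    by (simp del: transpose_matrix_vector add: vec_eq_iff matrix_vector_mult_def eigenbasis_matrix_def transpose_def inner_vec_def mult.commute)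
  ultimately show ?thesis by simp
qed

lemma eigenbasis_norm: "x \<bullet> x = (\<Sum>i\<in>UNIV. (q i \<bullet> x)\<^sup>2)"
  by (subst (2) eigenbasis_expansion) (simp add: inner_sum_right power2_eq_square inner_commute)

lemma eigenbasis_quadratic_form: "x \<bullet> (M *v x) = (\<Sum>i\<in>UNIV. e i * (q i \<bullet> x)\<^sup>2)"
proof -
  have "M *v (\<Sum>i\<in>UNIV. (q i \<bullet> x) *\<^sub>R q i) = (\<Sum>i\<in>UNIV. (q i \<bullet> x) *\<^sub>R (e i *\<^sub>R q i))"
    by (simp add: linear_sum[OF matrix_vector_mul_linear] matrix_vector_mult_scaleR eigen)
  then have "M *v x = (\<Sum>i\<in>UNIV. (q i \<bullet> x) *\<^sub>R (e i *\<^sub>R q i))"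
    by (simp flip: eigenbasis_expansion)
  then show ?thesis
    by (simp add: inner_sum_right power2_eq_square inner_commute mult_ac)
qed

lemma eigenvalue_eq_quadratic_form: "e i = q i \<bullet> (M *v q i)"
  by (simp add: eigen orthonormal)

lemma eigenvalue_ge:
  assumes "\<And>\<xi>. \<xi> \<bullet> (M *v \<xi>) \<ge> a * (\<xi> \<bullet> \<xi>) + b * (x \<bullet> \<xi>)\<^sup>2"
  shows "e i \<ge> a + b * (q i \<bullet> x)\<^sup>2"
  using assms[of "q i"] by (simp add: eigenvalue_eq_quadratic_form orthonormal inner_commute)

end

text \<open>The matrix \<open>a I + b x \<otimes> x\<close> on the right-hand side of the hypothesis on \<open>M\<close> has the
  eigenvalues \<open>a\<close>, with multiplicity \<open>n - 1\<close>, and \<open>a + b |x|\<^sup>2\<close>.\<close>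

lemma pucci_plus_ge:
  fixes M :: "real^'n^'n"
  assumes "transpose M = M" and lam: "0 < lam" "lam \<le> Lam"
    and M: "\<And>\<xi>. \<xi> \<bullet> (M *v \<xi>) \<ge> a * (\<xi> \<bullet> \<xi>) + b * (x \<bullet> \<xi>)\<^sup>2" and "x \<noteq> 0"
  shows "pucci_plus lam Lam M \<ge> Lam * (a + b * (x \<bullet> x)) + lam * (real CARD('n) - 1) * a"
proof -
  obtain q :: "'n \<Rightarrow> real^'n" and e where orthonormal: "\<And>i j. q i \<bullet> q j = (if i = j then 1 else 0)"
    and eigen: "\<And>i. M *v q i = e i *\<^sub>R q i"
    using symmetric_matrix_eigenbasis[OF assms(1)] by metis
  note basis = orthonormal eigen
  define s where "s = x \<bullet> x"
  have s: "s > 0" using \<open>x \<noteq> 0\<close> by (simp add: s_def)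
  \<comment> \<open>The weights are the squared coordinates of \<open>x / |x|\<close> in the
    eigenbasis: they sum to 1, and the weighted mean of the eigenvalues is the Rayleigh quotient of
    \<open>M\<close> at \<open>x\<close>.\<close>
  define c where "c i = (q i \<bullet> x)\<^sup>2 / s" for i
  have c1: "(\<Sum>i\<in>UNIV. c i) = 1"
    using eigenbasis_norm[OF basis, of x] s by (simp add: c_def s_def flip: sum_divide_distrib)
  have c: "0 \<le> c i" "c i \<le> 1" for i
    using s c1 member_le_sum[of i UNIV c] by (auto simp: c_def)
  have "(\<Sum>i\<in>UNIV. c i * e i) = x \<bullet> (M *v x) / s"
    unfolding eigenbasis_quadratic_form[OF basis] sum_divide_distrib c_def by (simp add: mult.commute)
  also have "\<dots> \<ge> (a * s + b * s\<^sup>2) / s"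
    using M[of x] s by (intro divide_right_mono) (auto simp: s_def)
  also have "(a * s + b * s\<^sup>2) / s = a + b * s"
    using s by (simp add: power2_eq_square add_divide_distrib)
  finally have ce: "(\<Sum>i\<in>UNIV. c i * e i) \<ge> a + b * s" .
  have tr: "(\<Sum>i\<in>UNIV. e i) \<ge> a * real CARD('n) + b * s"
  proof -
    have "(\<Sum>i\<in>UNIV. e i) \<ge> (\<Sum>i\<in>UNIV. a + b * (q i \<bullet> x)\<^sup>2)"
      by (intro sum_mono eigenvalue_ge[OF basis M])
    then show ?thesis
      using eigenbasis_norm[OF basis, of x] by (simp add: sum.distrib s_def mult.commute flip: sum_distrib_left)
  qed
  \<comment> \<open>\<open>pucci_plus\<close> is the largest value over coefficients between
    \<open>lam\<close> and \<open>Lam\<close>. The coefficients chosen here are the diagonal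
    entries, in the eigenbasis, of \<open>lam I + (Lam - lam) x \<otimes> x / |x|\<^sup>2\<close>,
    so only the trace and the Rayleigh quotient at \<open>x\<close> remain.\<close>
  have "pucci_plus lam Lam M \<ge> (\<Sum>i\<in>UNIV. (lam + (Lam - lam) * c i) * e i)"
    unfolding pucci_plus_eigenbasis[OF basis]
  proof (rule sum_mono)
    fix i
    have 1: "(Lam - lam) * c i \<ge> 0" "(Lam - lam) * c i \<le> Lam - lam"
      using c[of i] lam by (auto intro: mult_left_le)
    then show "(lam + (Lam - lam) * c i) * e i \<le> (if e i > 0 then Lam else lam) * e i"
      by (auto intro!: mult_right_mono mult_right_mono_neg)
  qed
  moreover have "(\<Sum>i\<in>UNIV. (lam + (Lam - lam) * c i) * e i)
      = lam * (\<Sum>i\<in>UNIV. e i) + (Lam - lam) * (\<Sum>i\<in>UNIV. c i * e i)"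
    by (simp add: sum_distrib_left algebra_simps flip: sum.distrib)
  moreover have "\<dots> \<ge> lam * (a * real CARD('n) + b * s) + (Lam - lam) * (a + b * s)"
    using lam ce tr by (intro add_mono mult_left_mono) auto
  ultimately show ?thesis by (simp add: s_def algebra_simps)
qed

text \<open>\<open>pucci_minus\<close> takes the least favorable coefficient for each eigenvalue.
  The eigenvalue is at least a convex combination of \<open>a \<le> 0\<close> and
  \<open>a + b |x|\<^sup>2 \<ge> 0\<close>; these signs allow the coefficient to be replaced by
  \<open>Lam\<close> in the first part and by \<open>lam\<close> in the second.\<close>

lemma pucci_minus_ge:
  fixes M :: "real^'n^'n"
  assumes "transpose M = M" and lam: "0 < lam" "lam \<le> Lam"
    and M: "\<And>\<xi>. \<xi> \<bullet> (M *v \<xi>) \<ge> a * (\<xi> \<bullet> \<xi>) + b * (x \<bullet> \<xi>)\<^sup>2" and "x \<noteq> 0"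
    and a: "a \<le> 0" and ab: "a + b * (x \<bullet> x) \<ge> 0"
  shows "pucci_minus lam Lam M \<ge> lam * (a + b * (x \<bullet> x)) + Lam * (real CARD('n) - 1) * a"
proof -
  obtain q :: "'n \<Rightarrow> real^'n" and e where orthonormal: "\<And>i j. q i \<bullet> q j = (if i = j then 1 else 0)"
    and eigen: "\<And>i. M *v q i = e i *\<^sub>R q i"
    using symmetric_matrix_eigenbasis[OF assms(1)] by metis
  note basis = orthonormal eigen
  define s where "s = x \<bullet> x"
  have s: "s > 0" using \<open>x \<noteq> 0\<close> by (simp add: s_def)
  define c where "c i = (q i \<bullet> x)\<^sup>2 / s" for i
  have c1: "(\<Sum>i\<in>UNIV. c i) = 1"
    using eigenbasis_norm[OF basis, of x] s by (simp add: c_def s_def flip: sum_divide_distrib)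
  have c: "0 \<le> c i" "c i \<le> 1" for i
    using s c1 member_le_sum[of i UNIV c] by (auto simp: c_def)
  have "pucci_minus lam Lam M \<ge> (\<Sum>i\<in>UNIV. Lam * a * (1 - c i) + lam * (a + b * s) * c i)"
    unfolding pucci_minus_eigenbasis[OF basis]
  proof (rule sum_mono)
    fix i
    define \<theta> where "\<theta> = (if e i > 0 then lam else Lam)"
    have \<theta>: "lam \<le> \<theta>" "\<theta> \<le> Lam" using lam by (auto simp: \<theta>_def)
    have "Lam * (a * (1 - c i)) \<le> \<theta> * (a * (1 - c i))"
      using \<theta> a c[of i] by (intro mult_right_mono_neg) (auto intro: mult_nonpos_nonneg)
    moreover have "lam * ((a + b * s) * c i) \<le> \<theta> * ((a + b * s) * c i)"
      using \<theta> ab c[of i] by (intro mult_right_mono) (auto simp: s_def)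
    moreover have "\<theta> * (a + b * (q i \<bullet> x)\<^sup>2) \<le> \<theta> * e i"
      using \<theta> lam by (intro mult_left_mono eigenvalue_ge[OF basis M]) auto
    moreover have "(q i \<bullet> x)\<^sup>2 = s * c i" using s by (simp add: c_def)
    ultimately have "Lam * (a * (1 - c i)) + lam * ((a + b * s) * c i) \<le> \<theta> * e i"
      by (simp add: algebra_simps)
    then show "Lam * a * (1 - c i) + lam * (a + b * s) * c i \<le> (if e i > 0 then lam else Lam) * e i"
      by (simp add: \<theta>_def mult.assoc)
  qed
  also have "(\<Sum>i\<in>UNIV. Lam * a * (1 - c i) + lam * (a + b * s) * c i)
      = Lam * a * (real CARD('n) - 1) + lam * (a + b * s)"
    using c1 by (simp add: sum.distrib sum_subtractf flip: sum_distrib_left)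
  finally show ?thesis by (simp add: s_def algebra_simps)
qed

text \<open>This coarse bound serves contact points where the sign of the radial eigenvalue is
  unknown, the center among them.\<close>

lemma pucci_ge_dim:
  fixes M :: "real^'n^'n"
  assumes "transpose M = M" and lam: "0 < lam" "lam \<le> Lam"
    and M: "\<And>\<xi>. \<xi> \<bullet> (M *v \<xi>) \<ge> a * (\<xi> \<bullet> \<xi>)" and a: "a \<le> 0"
  shows "pucci_plus lam Lam M \<ge> Lam * real CARD('n) * a" "pucci_minus lam Lam M \<ge> Lam * real CARD('n) * a"
proof -
  obtain q :: "'n \<Rightarrow> real^'n" and e where orthonormal: "\<And>i j. q i \<bullet> q j = (if i = j then 1 else 0)"
    and eigen: "\<And>i. M *v q i = e i *\<^sub>R q i"
    using symmetric_matrix_eigenbasis[OF assms(1)] by metis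
  note basis = orthonormal eigen
  have ea: "e i \<ge> a" for i
  proof -
    have "e i \<ge> a + 0 * (q i \<bullet> 0)\<^sup>2"
      by (rule eigenvalue_ge[OF basis]) (simp add: M)
    then show ?thesis by simp
  qed
  have term_ge: "Lam * a \<le> \<theta> * e i" if "lam \<le> \<theta>" "\<theta> \<le> Lam" for \<theta> i
  proof -
    have "Lam * a \<le> \<theta> * a" using that a by (intro mult_right_mono_neg)
    also have "\<dots> \<le> \<theta> * e i"
      using that lam ea by (intro mult_left_mono) auto
    finally show ?thesis .
  qed
  have "(\<Sum>i\<in>(UNIV::'n set). Lam * a) \<le> (\<Sum>i\<in>UNIV. (if e i > 0 then Lam else lam) * e i)"
    "(\<Sum>i\<in>(UNIV::'n set). Lam * a) \<le> (\<Sum>i\<in>UNIV. (if e i > 0 then lam else Lam) * e i)"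
    by (intro sum_mono term_ge; use lam in simp)+
  then show "pucci_plus lam Lam M \<ge> Lam * real CARD('n) * a" "pucci_minus lam Lam M \<ge> Lam * real CARD('n) * a"
    unfolding pucci_plus_eigenbasis[OF basis] pucci_minus_eigenbasis[OF basis] by (simp_all add: mult_ac)
qed

subsection \<open>Radial comparison\<close>

text \<open>The radial function \<open>\<phi> (|x - x0|\<^sup>2)\<close>, whose Hessian is \<open>a I + b (x - x0) \<otimes> (x - x0)\<close> at \<open>z\<close>,
  touches \<open>v\<close> from below at \<open>z\<close> up to an additive constant.\<close>

definition touches_below :: "('a::real_normed_vector \<Rightarrow> real) \<Rightarrow> 'a \<Rightarrow> 'a \<Rightarrow> real \<Rightarrow> real \<Rightarrow> bool" where
  "touches_below v x0 z a b \<longleftrightarrow> (\<exists>\<phi> \<phi>'.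
     (\<forall>\<^sub>F s in nhds ((norm (z - x0))\<^sup>2). (\<phi> has_real_derivative \<phi>' s) (at s)) \<and>
     a = 2 * \<phi>' ((norm (z - x0))\<^sup>2) \<and>
     (\<phi>' has_real_derivative b / 4) (at ((norm (z - x0))\<^sup>2)) \<and>
     (\<forall>\<^sub>F y in nhds z. v z - \<phi> ((norm (z - x0))\<^sup>2) \<le> v y - \<phi> ((norm (y - x0))\<^sup>2)))"

text \<open>Collects what is used about the transformed solution. In the variable
  \<open>s = |x - x0|\<^sup>2\<close> the fundamental solution is \<open>s powr - \<beta>\<close>,
  so \<open>2 * \<beta> + 1\<close> is the effective dimension minus 1, the weight of the tangential
  eigenvalue \<open>a\<close> against the radial one. \<open>touch\<close> is the sharp inequality
  for decreasing, radially convex test functions; \<open>touch_center\<close> is a coarse one that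
  also covers \<open>x0\<close>.\<close>

locale radial_supersolution =
  fixes v :: "'a::euclidean_space \<Rightarrow> real" and x0 :: 'a and \<beta> \<kappa> K p :: real
  assumes cont: "continuous_on UNIV v" and nonneg: "v x \<ge> 0" and pos: "v x0 > 0"
    and params: "\<beta> > 0" "\<kappa> > 0" "K > 0" "p > 1"
    and touch: "touches_below v x0 z a b \<Longrightarrow> z \<noteq> x0 \<Longrightarrow> a \<le> 0 \<Longrightarrow> a + b * (norm (z - x0))\<^sup>2 \<ge> 0 \<Longrightarrow>
      (a + b * (norm (z - x0))\<^sup>2) + (2 * \<beta> + 1) * a \<le> - \<kappa> * v z powr p"
    and touch_center: "touches_below v x0 z a b \<Longrightarrow> a \<le> 0 \<Longrightarrow> b \<ge> 0 \<Longrightarrow> K * a \<le> - (v z powr p)"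
begin

abbreviation N :: "'a \<Rightarrow> real" where "N y \<equiv> (norm (y - x0))\<^sup>2"

lemma continuous_N: "continuous_on A N"
  by (intro continuous_intros)

lemma N_cball: "{y. N y \<le> T} = cball x0 (sqrt T)" if "T \<ge> 0"
  using that by (auto simp: dist_norm norm_minus_commute real_le_rsqrt sqrt_ge_absD)

lemma compact_N_le: "compact {y. N y \<le> T}"
proof (cases "T \<ge> 0")
  case True
  then show ?thesis by (simp add: N_cball)
next
  case False
  then have "N y > T" for y using zero_le_power2[of "norm (y - x0)"] by linarith
  then have "{y. N y \<le> T} = {}" by (auto simp: not_le)
  then show ?thesis by simp
qed

text \<open>The left side of \<open>strict\<close> is the radial operator with
  \<open>a = 2 * \<phi>'\<close> and \<open>b = 4 * \<phi>''\<close>. If \<phi> exceeded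
  \<open>v\<close> somewhere, \<open>v - \<phi>\<close> would have a negative minimum inside an
  annulus, a contact that contradicts \<open>touch\<close>.\<close>

lemma comparison:
  fixes \<phi> \<phi>' \<phi>'' :: "real \<Rightarrow> real"
  assumes \<rho>: "\<rho> > 0"
    and \<phi>: "\<And>s. s \<ge> \<rho> \<Longrightarrow> (\<phi> has_real_derivative \<phi>' s) (at s)"
    and \<phi>': "\<And>s. s > \<rho> \<Longrightarrow> (\<phi>' has_real_derivative \<phi>'' s) (at s)"
    and nonpos: "\<And>s. s > \<rho> \<Longrightarrow> \<phi>' s \<le> 0"
    and radial: "\<And>s. s > \<rho> \<Longrightarrow> \<phi>' s + 2 * s * \<phi>'' s \<ge> 0"
    and strict: "\<And>z. N z > \<rho> \<Longrightarrow> (4 * \<beta> + 4) * \<phi>' (N z) + 4 * N z * \<phi>'' (N z) > - \<kappa> * v z powr p"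
    and infinity: "(\<phi> \<longlongrightarrow> 0) at_top"
    and boundary: "\<And>z. N z = \<rho> \<Longrightarrow> \<phi> \<rho> \<le> v z"
    and y: "N y \<ge> \<rho>"
  shows "\<phi> (N y) \<le> v y"
proof (rule ccontr)
  assume "\<not> \<phi> (N y) \<le> v y"
  define \<delta> where "\<delta> = \<phi> (N y) - v y"
  have \<delta>: "\<delta> > 0" using \<open>\<not> \<phi> (N y) \<le> v y\<close> by (simp add: \<delta>_def)
  \<comment> \<open>As \<open>v \<ge> 0\<close>, this choice of \<open>S\<close> keeps
    \<open>v - \<phi>\<close> above \<open>- \<delta>\<close> on the outer sphere;
    \<open>boundary\<close> does so on the inner one. The minimum over the annulus is therefore
    interior.\<close>
  have "\<forall>\<^sub>F s in at_top. \<phi> s < \<delta> \<and> s > N y"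
    using order_tendstoD(2)[OF infinity \<delta>] eventually_gt_at_top by (rule eventually_conj)
  then obtain S where S: "\<phi> S < \<delta>" "S > N y"
    using eventually_happens' trivial_limit_at_top_linorder by blast
  define A where "A = {x. \<rho> \<le> N x \<and> N x \<le> S}"
  have "A = {x. N x \<le> S} \<inter> {x. \<rho> \<le> N x}" by (auto simp: A_def)
  then have "compact A"
    using compact_Int_closed[OF compact_N_le closed_Collect_le[OF continuous_on_const continuous_N]]
    by simp
  moreover have "A \<noteq> {}" using y S by (auto simp: A_def)
  moreover have "continuous_on A (\<lambda>x. v x - \<phi> (N x))"
  proof (intro continuous_on_diff)
    show "continuous_on A v" using cont continuous_on_subset by blast
    have "continuous_on {\<rho>..} \<phi>"
      using \<phi> by (intro continuous_at_imp_continuous_on) (auto intro: DERIV_isCont)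
    then show "continuous_on A (\<lambda>x. \<phi> (N x))"
      by (rule continuous_on_compose2[OF _ continuous_N]) (auto simp: A_def)
  qed
  ultimately obtain z where z: "z \<in> A" and zmin: "\<And>x. x \<in> A \<Longrightarrow> v z - \<phi> (N z) \<le> v x - \<phi> (N x)"
    using continuous_attains_inf[of A "\<lambda>x. v x - \<phi> (N x)"] by blast
  have "v z - \<phi> (N z) \<le> - \<delta>" using zmin[of y] y S by (simp add: A_def \<delta>_def)
  with boundary[of z] nonneg[of z] S \<delta> have "N z \<noteq> \<rho>" "N z \<noteq> S" by auto
  with z have Nz: "N z > \<rho>" "N z < S" by (auto simp: A_def)
  have "open ({x. \<rho> < N x} \<inter> {x. N x < S})"
    by (intro open_Int open_Collect_less continuous_N continuous_on_const)
  then have "\<forall>\<^sub>F x in nhds z. x \<in> {x. \<rho> < N x} \<inter> {x. N x < S}"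
    using Nz by (intro eventually_nhds_in_open) auto
  then have min: "\<forall>\<^sub>F x in nhds z. v z - \<phi> (N z) \<le> v x - \<phi> (N x)"
    by eventually_elim (auto intro!: zmin simp: A_def)
  have "\<forall>\<^sub>F s in nhds (N z). s \<in> {\<rho><..}"
    using Nz by (intro eventually_nhds_in_open) auto
  then have "\<forall>\<^sub>F s in nhds (N z). (\<phi> has_real_derivative \<phi>' s) (at s)"
    by eventually_elim (auto intro!: \<phi>)
  then have "touches_below v x0 z (2 * \<phi>' (N z)) (4 * \<phi>'' (N z))"
    unfolding touches_below_def using \<phi>'[OF Nz(1)] min by (intro exI[of _ \<phi>] exI[of _ \<phi>']) simp
  moreover have "z \<noteq> x0" using Nz \<rho> by auto
  ultimately have "(2 * \<phi>' (N z) + 4 * \<phi>'' (N z) * N z) + (2 * \<beta> + 1) * (2 * \<phi>' (N z)) \<le> - \<kappa> * v z powr p"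
    using nonpos[OF Nz(1)] radial[OF Nz(1)] by (intro touch) (auto simp: algebra_simps)
  with strict[OF Nz(1)] show False by (simp add: algebra_simps)
qed

section \<open>Lower bounds for supersolutions at infinity\<close>

lemma lower_bound_near_center:
  obtains \<rho> where "\<rho> > 0" "\<And>z. N z \<le> \<rho> \<Longrightarrow> v z \<ge> v x0 / 2"
proof -
  have "isCont v x0" using cont continuous_on_eq_continuous_at by blast
  then obtain d where d: "d > 0" "\<And>z. dist z x0 < d \<Longrightarrow> dist (v z) (v x0) < v x0 / 2"
    using pos unfolding continuous_at_eps_delta by (meson half_gt_zero)
  show ?thesis
  proof (rule that[of "(d / 2)\<^sup>2"])
    show "(d / 2)\<^sup>2 > 0" using d by simp
    fix z assume "N z \<le> (d / 2)\<^sup>2"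
    then have "norm (z - x0) \<le> d / 2" using d by (simp add: abs_le_square_iff[symmetric] flip: power2_le_iff_abs_le)
    then show "v z \<ge> v x0 / 2" using d(1) d(2)[of z] by (auto simp: dist_norm abs_if split: if_splits)
  qed
qed

text \<open>The radial operator maps \<open>s powr - \<gamma>\<close> to \<open>4 * \<gamma> *
  (\<gamma> - \<beta>) * s powr (- \<gamma> - 1)\<close>. It annihilates the exponent \<beta>, and
  adding the faster decaying power with \<open>\<gamma> = \<beta> + 1\<close> makes the subsolution
  strict.\<close>

lemma power_lower_bound:
  obtains c \<rho> where "c > 0" "\<rho> > 0" "\<And>z. N z \<ge> \<rho> \<Longrightarrow> v z \<ge> c * N z powr - \<beta>"
    "\<And>z. N z \<le> \<rho> \<Longrightarrow> v z \<ge> v x0 / 2"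
proof -
  obtain \<rho> where \<rho>: "\<rho> > 0" and near: "\<And>z. N z \<le> \<rho> \<Longrightarrow> v z \<ge> v x0 / 2"
    using lower_bound_near_center by blast
  define D where "D = \<rho> powr - \<beta> + \<rho> powr (- \<beta> - 1)"
  \<comment> \<open>This normalization gives \<open>\<phi> \<rho> = v x0 / 2\<close>, the lower
    bound available on the inner sphere.\<close>
  define c where "c = v x0 / 2 / D"
  have D: "D > 0" using \<rho> by (simp add: D_def add_pos_pos)
  then have c: "c > 0" using pos by (simp add: c_def)
  define \<phi> where "\<phi> s = c * (s powr - \<beta> + s powr (- \<beta> - 1))" for s
  define \<phi>' where "\<phi>' s = - c * (\<beta> * s powr (- \<beta> - 1) + (\<beta> + 1) * s powr (- \<beta> - 2))" for s
  define \<phi>'' where "\<phi>'' s = c * (\<beta> * (\<beta> + 1) * s powr (- \<beta> - 2) + (\<beta> + 1) * (\<beta> + 2) * s powr (- \<beta> - 3))" for s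
  have s\<phi>'': "s * \<phi>'' s = c * (\<beta> * (\<beta> + 1) * s powr (- \<beta> - 1) + (\<beta> + 1) * (\<beta> + 2) * s powr (- \<beta> - 2))"
    if "s > 0" for s
  proof -
    have "s * s powr (- \<beta> - 2) = s powr (- \<beta> - 1)" "s * s powr (- \<beta> - 3) = s powr (- \<beta> - 2)"
      using that by (simp_all add: powr_mult_base minus_diff_commute)
    moreover have "s * \<phi>'' s = c * (\<beta> * (\<beta> + 1) * (s * s powr (- \<beta> - 2))
        + (\<beta> + 1) * (\<beta> + 2) * (s * s powr (- \<beta> - 3)))"
      unfolding \<phi>''_def by (simp add: algebra_simps)
    ultimately show ?thesis by (simp only:)
  qed
  have le: "\<phi> (N z) \<le> v z" if "N z \<ge> \<rho>" for z
  proof (rule comparison[OF \<rho> _ _ _ _ _ _ _ that])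
    show "(\<phi> has_real_derivative \<phi>' s) (at s)" if "s \<ge> \<rho>" for s
      unfolding \<phi>_def \<phi>'_def using that \<rho>
      by (auto intro!: derivative_eq_intros simp: algebra_simps)
    show "(\<phi>' has_real_derivative \<phi>'' s) (at s)" if "s > \<rho>" for s
      unfolding \<phi>'_def \<phi>''_def using that \<rho>
      by (auto intro!: derivative_eq_intros simp: algebra_simps)
    show "\<phi>' s \<le> 0" for s
      unfolding \<phi>'_def using c params by simp
    show "\<phi>' s + 2 * s * \<phi>'' s \<ge> 0" if "s > \<rho>" for s
    proof -
      have "\<phi>' s + 2 * (s * \<phi>'' s) = c * (\<beta> * (2 * \<beta> + 1) * s powr (- \<beta> - 1)
          + (\<beta> + 1) * (2 * \<beta> + 3) * s powr (- \<beta> - 2))"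
        using s\<phi>''[of s] that \<rho> by (simp add: \<phi>'_def algebra_simps)
      also have "\<dots> \<ge> 0" using c params by simp
      finally show ?thesis by simp
    qed
    show "(4 * \<beta> + 4) * \<phi>' (N z) + 4 * N z * \<phi>'' (N z) > - \<kappa> * v z powr p" if "N z > \<rho>" for z
    proof -
      have Nz: "N z > 0" using that \<rho> by linarith
      have "(4 * \<beta> + 4) * \<phi>' (N z) + 4 * (N z * \<phi>'' (N z)) = 4 * c * (\<beta> + 1) * N z powr (- \<beta> - 2)"
        using s\<phi>''[OF Nz] by (simp add: \<phi>'_def algebra_simps)
      also have "\<dots> > 0" using c params Nz by (intro mult_pos_pos) auto
      finally have "(4 * \<beta> + 4) * \<phi>' (N z) + 4 * N z * \<phi>'' (N z) > 0" by (simp only: mult.assoc)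
      moreover have "- \<kappa> * v z powr p \<le> 0" using params by simp
      ultimately show ?thesis by linarith
    qed
    show "(\<phi> \<longlongrightarrow> 0) at_top"
      unfolding \<phi>_def using params by real_asymp
    show "\<phi> \<rho> \<le> v z" if "N z = \<rho>" for z
      using near[of z] that D by (simp add: \<phi>_def c_def D_def[symmetric])
  qed
  show ?thesis
  proof (rule that[OF c \<rho> _ near])
    fix z assume "N z \<ge> \<rho>"
    from le[OF this] show "v z \<ge> c * N z powr - \<beta>"
      using c by (simp add: \<phi>_def distrib_left) (smt (verit) mult_nonneg_nonneg powr_ge_zero)
  qed
qed

text \<open>A strong maximum principle: positivity at one point spreads everywhere. It permits
  division by \<open>v\<close> in \<open>decay_bound\<close>.\<close>

lemma positive: "v z > 0"
proof -
  obtain c \<rho> where "c > 0" "\<rho> > 0" "\<And>z. N z \<ge> \<rho> \<Longrightarrow> v z \<ge> c * N z powr - \<beta>"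
    "\<And>z. N z \<le> \<rho> \<Longrightarrow> v z \<ge> v x0 / 2" using power_lower_bound by blast
  moreover have "c * N z powr - \<beta> > 0" if "N z \<ge> \<rho>"
    using \<open>c > 0\<close> \<open>\<rho> > 0\<close> that by (intro mult_pos_pos) auto
  ultimately show ?thesis using pos by (smt (verit) half_gt_zero)
qed

text \<open>The equation turns the bound \<open>v \<ge> c r\<^sup>-\<^sup>\<alpha>\<close>, \<open>\<alpha> = 2 \<beta>\<close>, into a source of size at least
  \<open>r\<^sup>-\<^sup>\<alpha>\<^sup>-\<^sup>2\<close>, which gains a logarithm.\<close>

lemma log_lower_bound:
  assumes crit: "\<beta> * p \<le> \<beta> + 1"
  obtains \<epsilon> \<rho> where "\<epsilon> > 0" "\<rho> > 0" "\<And>z. N z \<ge> \<rho> \<Longrightarrow> v z \<ge> \<epsilon> * (N z powr - \<beta> * ln (N z))"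
    "\<And>s t. \<rho> \<le> s \<Longrightarrow> s \<le> t \<Longrightarrow> t powr - \<beta> * ln t \<le> s powr - \<beta> * ln s"
proof -
  obtain c \<rho>0 where c: "c > 0" and \<rho>0: "\<rho>0 > 0" and low: "\<And>z. N z \<ge> \<rho>0 \<Longrightarrow> v z \<ge> c * N z powr - \<beta>"
    using power_lower_bound by metis
  \<comment> \<open>For \<open>ln s \<ge> L\<close> the first summand yields
    \<open>\<beta> * ln s \<ge> 1\<close>, hence \<open>\<phi>' \<le> 0\<close>, and the second
    yields radial convexity of the comparison function.\<close>
  define L where "L = 1 / \<beta> + (4 * \<beta> + 1) / (\<beta> * (2 * \<beta> + 1))"
  define \<rho> where "\<rho> = max \<rho>0 (exp L)"
  have \<rho>: "\<rho> > 0" "\<rho> \<ge> \<rho>0" using \<rho>0 by (auto simp: \<rho>_def)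
  have L: "L \<ge> 1 / \<beta>" "L \<ge> (4 * \<beta> + 1) / (\<beta> * (2 * \<beta> + 1))" "L > 0"
    using params by (auto simp: L_def intro: add_pos_pos)
  have ln: "ln s \<ge> L" "s \<ge> 1" if "s \<ge> \<rho>" for s
  proof -
    have "s \<ge> exp L" using that by (simp add: \<rho>_def)
    moreover from this have "s > 0" using exp_gt_zero less_le_trans by blast
    ultimately show "ln s \<ge> L" by (simp add: ln_ge_iff)
    with L \<open>s > 0\<close> show "s \<ge> 1" by (smt (verit) ln_less_zero)
  qed
  have ln1: "\<beta> * ln s \<ge> 1" if "s \<ge> \<rho>" for s
  proof -
    have "1 / \<beta> \<le> ln s" using ln[OF that] L(1) by linarith
    then show ?thesis using params by (simp add: divide_le_eq mult.commute)
  qed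
  have ln2: "\<beta> * (2 * \<beta> + 1) * ln s \<ge> 4 * \<beta> + 1" if "s \<ge> \<rho>" for s
  proof -
    have "(4 * \<beta> + 1) / (\<beta> * (2 * \<beta> + 1)) \<le> ln s" using ln[OF that] L(2) by linarith
    then show ?thesis using params by (simp add: divide_le_eq mult.commute)
  qed
  \<comment> \<open>The first entry settles the inner boundary. For the second, the radial operator
    maps \<open>s powr - \<beta> * ln s\<close> to
    \<open>- 4 * \<beta> * s powr (- \<beta> - 1)\<close>, whose size must stay below that of the
    source; 8 in place of 4 makes this strict.\<close>
  define \<epsilon> where "\<epsilon> = min (c / ln \<rho>) (\<kappa> * c powr p / (8 * \<beta>))"
  have ln\<rho>: "ln \<rho> > 0" using ln(1)[of \<rho>] L(3) by linarith
  have \<epsilon>: "\<epsilon> > 0" using c ln\<rho> params by (simp add: \<epsilon>_def)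
  have \<epsilon>1: "\<epsilon> * ln \<rho> \<le> c"
  proof -
    have "\<epsilon> \<le> c / ln \<rho>" by (simp add: \<epsilon>_def)
    then show ?thesis using ln\<rho> by (simp add: pos_le_divide_eq)
  qed
  have "\<epsilon> \<le> \<kappa> * c powr p / (8 * \<beta>)" by (simp add: \<epsilon>_def)
  then have "8 * \<beta> * \<epsilon> \<le> \<kappa> * c powr p" using params by (simp add: pos_le_divide_eq mult.commute)
  moreover have "4 * \<beta> * \<epsilon> < 8 * \<beta> * \<epsilon>" using params \<epsilon> by simp
  ultimately have \<epsilon>2: "4 * \<beta> * \<epsilon> < \<kappa> * c powr p" by linarith
  define \<phi> where "\<phi> s = \<epsilon> * (s powr - \<beta> * ln s)" for s
  define \<phi>' where "\<phi>' s = \<epsilon> * (s powr (- \<beta> - 1) * (1 - \<beta> * ln s))" for s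
  define \<phi>'' where "\<phi>'' s = \<epsilon> * (s powr (- \<beta> - 2) * (\<beta> * (\<beta> + 1) * ln s - (2 * \<beta> + 1)))" for s
  have s\<phi>'': "s * \<phi>'' s = \<epsilon> * (s powr (- \<beta> - 1) * (\<beta> * (\<beta> + 1) * ln s - (2 * \<beta> + 1)))"
    if "s > 0" for s
  proof -
    have "s * s powr (- \<beta> - 2) = s powr (- \<beta> - 1)"
      using that by (simp add: powr_mult_base minus_diff_commute)
    moreover have "s * \<phi>'' s = \<epsilon> * (s * s powr (- \<beta> - 2) * (\<beta> * (\<beta> + 1) * ln s - (2 * \<beta> + 1)))"
      unfolding \<phi>''_def by (simp add: algebra_simps)
    ultimately show ?thesis by (simp only:)
  qed
  have \<phi>: "(\<phi> has_real_derivative \<phi>' s) (at s)" if "s \<ge> \<rho>" for s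
  proof -
    have "s > 0" using that \<rho> by simp
    then have "s powr - \<beta> = s * s powr (- \<beta> - 1)" by (simp add: powr_mult_base minus_diff_commute)
    with \<open>s > 0\<close> show ?thesis unfolding \<phi>_def \<phi>'_def
      by (auto intro!: derivative_eq_intros simp: field_simps)
  qed
  have \<phi>': "(\<phi>' has_real_derivative \<phi>'' s) (at s)" if "s \<ge> \<rho>" for s
  proof -
    have "s > 0" using that \<rho> by simp
    then have "s powr (- \<beta> - 1) = s * s powr (- \<beta> - 2)" by (simp add: powr_mult_base minus_diff_commute)
    with \<open>s > 0\<close> show ?thesis unfolding \<phi>'_def \<phi>''_def
      by (auto intro!: derivative_eq_intros simp: field_simps)
  qed
  have nonpos: "\<phi>' s \<le> 0" if "s \<ge> \<rho>" for s
    unfolding \<phi>'_def using \<epsilon> ln1[OF that] by (intro mult_nonneg_nonpos) auto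
  have le: "\<phi> (N z) \<le> v z" if "N z \<ge> \<rho>" for z
  proof (rule comparison[OF \<rho>(1) \<phi> \<phi>' nonpos _ _ _ _ that])
    show "\<phi>' s + 2 * s * \<phi>'' s \<ge> 0" if "s > \<rho>" for s
    proof -
      have "\<phi>' s + 2 * (s * \<phi>'' s) = \<epsilon> * (s powr (- \<beta> - 1) * (\<beta> * (2 * \<beta> + 1) * ln s - (4 * \<beta> + 1)))"
        using s\<phi>''[of s] that \<rho> by (simp add: \<phi>'_def algebra_simps)
      also have "\<dots> \<ge> 0" using \<epsilon> ln2[of s] that by simp
      finally show ?thesis by simp
    qed
    show "(4 * \<beta> + 4) * \<phi>' (N z) + 4 * N z * \<phi>'' (N z) > - \<kappa> * v z powr p" if Nz: "N z > \<rho>" for z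
    proof -
      define s where "s = N z"
      have s: "s > 0" "s \<ge> 1" using ln[of s] \<rho> Nz by (auto simp: s_def)
      \<comment> \<open>Here the bound on \<open>p\<close> enters: for \<open>s \<ge> 1\<close> the
        source, of order at least \<open>s powr (- \<beta> * p)\<close>, dominates
        \<open>s powr (- \<beta> - 1)\<close>.\<close>
      have "s powr (- \<beta> - 1) \<le> s powr (- \<beta> * p)"
        using s crit by (intro powr_mono) auto
      then have "c powr p * s powr (- \<beta> - 1) \<le> (c * s powr - \<beta>) powr p"
        using c s by (simp add: powr_mult powr_powr)
      also have "\<dots> \<le> v z powr p"
        using low[of z] Nz \<rho> c params by (intro powr_mono2) (auto simp: s_def)
      finally have "\<kappa> * (c powr p * s powr (- \<beta> - 1)) \<le> \<kappa> * v z powr p"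
        using params by simp
      moreover have "4 * \<beta> * \<epsilon> * s powr (- \<beta> - 1) < \<kappa> * c powr p * s powr (- \<beta> - 1)"
        using \<epsilon>2 s by (intro mult_strict_right_mono) auto
      moreover have "(4 * \<beta> + 4) * \<phi>' s + 4 * (s * \<phi>'' s) = - (4 * \<beta> * \<epsilon> * s powr (- \<beta> - 1))"
        using s\<phi>''[of s] s by (simp add: \<phi>'_def algebra_simps)
      ultimately show ?thesis by (simp add: s_def)
    qed
    show "(\<phi> \<longlongrightarrow> 0) at_top"
      unfolding \<phi>_def using params by real_asymp
    show "\<phi> \<rho> \<le> v z" if "N z = \<rho>" for z
    proof -
      have "\<phi> \<rho> \<le> c * \<rho> powr - \<beta>"
        using mult_right_mono[OF \<epsilon>1, of "\<rho> powr - \<beta>"] by (simp add: \<phi>_def mult_ac)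
      also have "\<dots> \<le> v z" using low[of z] that \<rho> by simp
      finally show ?thesis .
    qed
  qed auto
  \<comment> \<open>Monotonicity lets \<open>supercritical\<close> replace the bound at a point by
    its value at a larger radius.\<close>
  have mono: "t powr - \<beta> * ln t \<le> s powr - \<beta> * ln s" if "\<rho> \<le> s" "s \<le> t" for s t
  proof -
    have "\<phi> t \<le> \<phi> s"
      using that \<phi> nonpos by (intro DERIV_nonpos_imp_nonincreasing[of s t \<phi>]) (auto intro: order_trans)
    then show ?thesis using \<epsilon> by (simp add: \<phi>_def)
  qed
  show ?thesis using that[OF \<epsilon> \<rho>(1) _ mono] le by (simp add: \<phi>_def)
qed

text \<open>Slide the multiples of \<open>(1 - |x - x0|\<^sup>2 / T)\<^sup>2\<close> up to the first contact with \<open>v\<close>. The contact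
  is not close to the boundary sphere, where the radial convexity of the test function dominates.\<close>

lemma decay_bound:
  assumes T: "T > 0"
  obtains z where "N z < T" "v z powr (p - 1) \<le> 4 * K * (\<beta> + 2)\<^sup>2 / T"
proof -
  \<comment> \<open>The maximum of the ratio \<open>h\<close> of bump to \<open>v\<close> determines
    the largest multiple, \<open>k = 1 / h z\<close>, of the bump that stays below \<open>v\<close>;
    contact occurs at the maximum point.\<close>
  define h where "h y = (1 - N y / T)\<^sup>2 / v y" for y
  have "compact {y. N y \<le> T}" by (rule compact_N_le)
  moreover have "x0 \<in> {y. N y \<le> T}" using T by simp
  moreover have "continuous_on {y. N y \<le> T} h"
    unfolding h_def using cont positive T
    by (intro continuous_intros) (auto intro: continuous_on_subset simp: less_imp_neq[THEN not_sym])
  ultimately obtain z where z: "N z \<le> T" and max: "\<And>y. N y \<le> T \<Longrightarrow> h y \<le> h z"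
    using continuous_attains_sup[of "{y. N y \<le> T}" h] by blast
  have "h x0 > 0" using pos by (simp add: h_def)
  then have hz: "h z > 0" using max[of x0] T by simp
  then have "N z \<noteq> T" using T by (auto simp: h_def)
  with z have Nz: "N z < T" by simp
  define \<sigma> where "\<sigma> = N z / T"
  have \<sigma>: "0 \<le> \<sigma>" "\<sigma> < 1" using Nz T by (auto simp: \<sigma>_def)
  define k where "k = 1 / h z"
  have k: "k > 0" using hz by (simp add: k_def)
  have vz: "v z = k * (1 - \<sigma>)\<^sup>2"
    using hz positive[of z] by (auto simp: k_def h_def \<sigma>_def field_simps)
  have vy: "v y \<ge> k * (1 - N y / T)\<^sup>2" if "N y \<le> T" for y
    using max[OF that] hz positive[of y] by (simp add: k_def h_def[of y] pos_divide_le_eq mult.commute divide_le_eq)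
  define \<phi> where "\<phi> s = k * (1 - s / T)\<^sup>2" for s
  define \<phi>' where "\<phi>' s = - 2 * k / T * (1 - s / T)" for s
  have touch_z: "touches_below v x0 z (- 4 * k / T * (1 - \<sigma>)) (8 * k / T\<^sup>2)"
    unfolding touches_below_def
  proof (intro exI conjI)
    show "\<forall>\<^sub>F s in nhds (N z). (\<phi> has_real_derivative \<phi>' s) (at s)"
      unfolding \<phi>_def \<phi>'_def using T
      by (intro always_eventually allI)
        (auto intro!: derivative_eq_intros simp: field_simps power2_eq_square)
    show "- 4 * k / T * (1 - \<sigma>) = 2 * \<phi>' (N z)" by (simp add: \<phi>'_def \<sigma>_def)
    show "(\<phi>' has_real_derivative 8 * k / T\<^sup>2 / 4) (at (N z))"
      unfolding \<phi>'_def using T by (auto intro!: derivative_eq_intros simp: field_simps power2_eq_square)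
    have "open {y. N y < T}" by (intro open_Collect_less continuous_N continuous_on_const)
    then have "\<forall>\<^sub>F y in nhds z. y \<in> {y. N y < T}" using Nz by (intro eventually_nhds_in_open) auto
    then show "\<forall>\<^sub>F y in nhds z. v z - \<phi> (N z) \<le> v y - \<phi> (N y)"
      by eventually_elim (use vy vz in \<open>simp add: \<phi>_def \<sigma>_def\<close>)
  qed
  have a: "- 4 * k / T * (1 - \<sigma>) \<le> 0"
    using k T \<sigma> by (intro mult_nonpos_nonneg) auto
  \<comment> \<open>For larger \<sigma> the bump is radially convex at \<open>z\<close>, and the
    radial operator, \<open>4 * k / T\<close> times
    \<open>3 * \<sigma> - 1 - (2 * \<beta> + 1) * (1 - \<sigma>)\<close>, is positive there, against
    \<open>touch\<close>.\<close>
  have "\<sigma> * (\<beta> + 2) \<le> \<beta> + 1"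
  proof (rule ccontr)
    assume "\<not> \<sigma> * (\<beta> + 2) \<le> \<beta> + 1"
    then have gt: "\<sigma> * (\<beta> + 2) > \<beta> + 1" by simp
    have eq: "8 * k / T\<^sup>2 * N z = 4 * k / T * (2 * \<sigma>)" using T by (simp add: \<sigma>_def power2_eq_square)
    from gt have "3 * \<sigma> - 1 - (2 * \<beta> + 1) * (1 - \<sigma>) > 0" by (simp add: algebra_simps)
    moreover have "(2 * \<beta> + 1) * (1 - \<sigma>) \<ge> 0" using params \<sigma> by simp
    ultimately have 1: "3 * \<sigma> - 1 \<ge> 0" "4 * k / T * (3 * \<sigma> - 1 - (2 * \<beta> + 1) * (1 - \<sigma>)) > 0"
      using k T by (linarith, intro mult_pos_pos) auto
    have "z \<noteq> x0" using gt params by (auto simp: \<sigma>_def)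
    have "- 4 * k / T * (1 - \<sigma>) + 8 * k / T\<^sup>2 * N z = 4 * k / T * (3 * \<sigma> - 1)"
      unfolding eq using T by (simp add: field_simps)
    moreover from this have "\<dots> + (2 * \<beta> + 1) * (- 4 * k / T * (1 - \<sigma>)) \<le> - \<kappa> * v z powr p"
      using touch[OF touch_z \<open>z \<noteq> x0\<close> a] 1 k T by simp
    moreover have "4 * k / T * (3 * \<sigma> - 1) + (2 * \<beta> + 1) * (- 4 * k / T * (1 - \<sigma>))
        = 4 * k / T * (3 * \<sigma> - 1 - (2 * \<beta> + 1) * (1 - \<sigma>))"
      using T by (simp add: field_simps)
    moreover have "- \<kappa> * v z powr p \<le> 0" using params by simp
    ultimately show False using 1(2) by linarith
  qed
  \<comment> \<open>Away from the boundary \<open>k\<close> is at most a constant times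
    \<open>v z\<close>, so \<open>touch_center\<close>, where \<open>a\<close> is of order
    \<open>k / T\<close>, turns into a bound on \<open>v z powr (p - 1)\<close>.\<close>
  then have "1 \<le> (1 - \<sigma>) * (\<beta> + 2)" by (simp add: algebra_simps)
  then have "1 \<le> ((1 - \<sigma>) * (\<beta> + 2))\<^sup>2" by (simp add: one_le_power)
  then have "k \<le> v z * (\<beta> + 2)\<^sup>2"
    using k mult_left_mono[of 1 "((1 - \<sigma>) * (\<beta> + 2))\<^sup>2" k] by (simp add: vz power_mult_distrib mult_ac)
  then have "4 * K / T * k \<le> 4 * K / T * (v z * (\<beta> + 2)\<^sup>2)"
    using params T by (intro mult_left_mono) auto
  moreover have "4 * K / T * k * (1 - \<sigma>) \<le> 4 * K / T * k"
    using params T k \<sigma> by (intro mult_left_le) auto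
  moreover have "v z powr p \<le> 4 * K / T * k * (1 - \<sigma>)"
    using touch_center[OF touch_z a] k T by (simp add: mult_ac)
  ultimately have "v z powr p \<le> 4 * K / T * (v z * (\<beta> + 2)\<^sup>2)" by linarith
  moreover have "v z powr p = v z * v z powr (p - 1)" using positive[of z] by (simp add: powr_mult_base minus_diff_commute)
  ultimately have "v z powr (p - 1) \<le> 4 * K * (\<beta> + 2)\<^sup>2 / T"
    using positive[of z] T by (simp add: field_simps)
  with Nz show ?thesis by (rule that)
qed

text \<open>At the point of the ball \<open>N < T\<close> from \<open>decay_bound\<close>,
  \<open>v\<close> is at least \<open>\<epsilon> * (T powr - \<beta> * ln T)\<close>. Raised to the
  power \<open>p - 1\<close>, with \<open>\<beta> * (p - 1) \<le> 1\<close>, this would bound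
  \<open>(\<epsilon> * ln T) powr (p - 1)\<close> independently of \<open>T\<close>.\<close>

lemma supercritical: "\<beta> * p > \<beta> + 1"
proof (rule ccontr)
  assume "\<not> \<beta> * p > \<beta> + 1"
  then have crit: "\<beta> * p \<le> \<beta> + 1" by simp
  obtain \<epsilon> \<rho> where \<epsilon>: "\<epsilon> > 0" and \<rho>: "\<rho> > 0"
    and low: "\<And>z. N z \<ge> \<rho> \<Longrightarrow> v z \<ge> \<epsilon> * (N z powr - \<beta> * ln (N z))"
    and mono: "\<And>s t. \<rho> \<le> s \<Longrightarrow> s \<le> t \<Longrightarrow> t powr - \<beta> * ln t \<le> s powr - \<beta> * ln s"
    using log_lower_bound[OF crit] by metis
  obtain y where y: "\<And>z. N z \<le> \<rho> \<Longrightarrow> v y \<le> v z"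
    using continuous_attains_inf[OF compact_N_le[of \<rho>], of v] cont \<rho>
    by (force intro: continuous_on_subset)
  define C where "C = 4 * K * (\<beta> + 2)\<^sup>2"
  have "\<forall>\<^sub>F T in at_top. \<epsilon> * (T powr - \<beta> * ln T) < v y"
    using positive[of y] params by (intro order_tendstoD(2)[of _ 0]) real_asymp
  moreover have "\<forall>\<^sub>F T in at_top. (\<epsilon> * ln T) powr (p - 1) > C"
    using \<epsilon> params
    by (intro filterlim_at_top_dense[THEN iffD1, rule_format]) real_asymp
  ultimately have "\<forall>\<^sub>F T in at_top. \<epsilon> * (T powr - \<beta> * ln T) < v y \<and> (\<epsilon> * ln T) powr (p - 1) > C
      \<and> T > max 1 \<rho>"
    using eventually_gt_at_top by (intro eventually_conj)
  then obtain T where T: "\<epsilon> * (T powr - \<beta> * ln T) < v y" "(\<epsilon> * ln T) powr (p - 1) > C" "T > 1" "T > \<rho>"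
    using eventually_happens' trivial_limit_at_top_linorder by fastforce
  then obtain z where z: "N z < T" "v z powr (p - 1) \<le> C / T"
    using decay_bound[of T] by (auto simp: C_def)
  have "\<epsilon> * (T powr - \<beta> * ln T) \<le> v z"
  proof (cases "N z \<ge> \<rho>")
    case True
    then have "\<epsilon> * (T powr - \<beta> * ln T) \<le> \<epsilon> * (N z powr - \<beta> * ln (N z))"
      using mono[of "N z" T] z \<epsilon> by simp
    then show ?thesis using low[OF True] by linarith
  next
    case False
    then show ?thesis using y[of z] T(1) by simp
  qed
  then have "(\<epsilon> * (T powr - \<beta> * ln T)) powr (p - 1) \<le> v z powr (p - 1)"
    using \<epsilon> T params by (intro powr_mono2) auto
  also have "\<dots> \<le> C / T" by (rule z)
  also have "(\<epsilon> * (T powr - \<beta> * ln T)) powr (p - 1) = (\<epsilon> * ln T) powr (p - 1) * T powr (- \<beta> * (p - 1))"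
    using \<epsilon> T by (simp add: powr_mult powr_powr mult_ac)
  finally have 1: "(\<epsilon> * ln T) powr (p - 1) * T powr (- \<beta> * (p - 1)) \<le> C / T" .
  have "1 / T = T powr (- 1)" using T by (simp add: powr_minus_divide)
  also have "\<dots> \<le> T powr (- \<beta> * (p - 1))" using T crit by (intro powr_mono) (auto simp: algebra_simps)
  finally have "(\<epsilon> * ln T) powr (p - 1) * (1 / T) \<le> (\<epsilon> * ln T) powr (p - 1) * T powr (- \<beta> * (p - 1))"
    by (intro mult_left_mono) auto
  with 1 have "(\<epsilon> * ln T) powr (p - 1) / T \<le> C / T" by simp
  then show False using T by (simp add: divide_le_cancel)
qed

end

subsection \<open>Classical solutions\<close>

lemma has_derivative_grad:
  fixes u :: "real^'n \<Rightarrow> real"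
  assumes "u differentiable (at x)"
  shows "(u has_derivative (\<lambda>\<xi>. grad u x \<bullet> \<xi>)) (at x)"
proof -
  let ?D = "frechet_derivative u (at x)"
  have D: "(u has_derivative ?D) (at x)" using assms frechet_derivative_works by blast
  then have "linear ?D" by (rule has_derivative_linear)
  have "?D \<xi> = grad u x \<bullet> \<xi>" for \<xi>
  proof -
    have "?D (\<Sum>i\<in>UNIV. \<xi> $ i *\<^sub>R axis i 1) = (\<Sum>i\<in>UNIV. \<xi> $ i *\<^sub>R ?D (axis i 1))"
      by (simp add: linear_sum[OF \<open>linear ?D\<close>] linear_scale[OF \<open>linear ?D\<close>])
    moreover have "(\<Sum>i\<in>UNIV. \<xi> $ i *\<^sub>R axis i 1) = \<xi>"
      using basis_expansion[of \<xi>] by (simp add: scalar_mult_eq_scaleR)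
    ultimately show ?thesis
      by (simp add: grad_def partial_def inner_vec_def mult.commute)
  qed
  with D show ?thesis by (metis (no_types, lifting) ext)
qed

lemma has_real_derivative_line:
  fixes u :: "real^'n \<Rightarrow> real"
  assumes "u differentiable (at (x + t *\<^sub>R \<xi>))"
  shows "((\<lambda>t. u (x + t *\<^sub>R \<xi>)) has_real_derivative grad u (x + t *\<^sub>R \<xi>) \<bullet> \<xi>) (at t)"
proof -
  have "((\<lambda>t. x + t *\<^sub>R \<xi>) has_derivative (\<lambda>h. h *\<^sub>R \<xi>)) (at t)"
    by (auto intro!: derivative_eq_intros)
  from has_derivative_compose[OF this has_derivative_grad[OF assms]]
  show ?thesis
    by (rule has_derivative_imp_has_field_derivative) (simp add: mult.commute)
qed

lemma C2_differentiable:
  assumes "C2 u"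
  shows "u differentiable (at x)" "partial i u differentiable (at x)"
    "continuous_on UNIV (partial i (partial j u))"
  using assms by (auto simp: C2_def C1_def)

lemma grad_axis: "grad u x \<bullet> axis i 1 = partial i u x"
  by (simp add: grad_def inner_axis)

lemma has_real_derivative_axis:
  fixes u :: "real^'n \<Rightarrow> real"
  assumes "u differentiable (at (x + t *\<^sub>R axis i 1))"
  shows "((\<lambda>t. u (x + t *\<^sub>R axis i 1)) has_real_derivative partial i u (x + t *\<^sub>R axis i 1)) (at t)"
  using has_real_derivative_line[OF assms] by (simp add: grad_axis)

text \<open>The mean value theorem is used twice: in direction \<open>i\<close> for the difference
  of \<open>u\<close> along two parallel lines, then in direction \<open>j\<close> for
  \<open>partial i u\<close>.\<close>

lemma second_difference:
  fixes u :: "real^'n \<Rightarrow> real"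
  assumes "C2 u" "h > 0"
  shows "\<exists>s t. 0 < s \<and> s < h \<and> 0 < t \<and> t < h \<and>
    u (x + h *\<^sub>R axis i 1 + h *\<^sub>R axis j 1) - u (x + h *\<^sub>R axis i 1) - u (x + h *\<^sub>R axis j 1) + u x
      = h\<^sup>2 * partial j (partial i u) (x + s *\<^sub>R axis i 1 + t *\<^sub>R axis j 1)"
proof -
  let ?a = "axis i 1 :: real^'n" and ?b = "axis j 1 :: real^'n"
  define A where "A s = u ((x + h *\<^sub>R ?b) + s *\<^sub>R ?a) - u (x + s *\<^sub>R ?a)" for s
  have "(A has_real_derivative
      partial i u ((x + h *\<^sub>R ?b) + s *\<^sub>R ?a) - partial i u (x + s *\<^sub>R ?a)) (at s)" for s
    unfolding A_def
    by (intro DERIV_diff has_real_derivative_axis C2_differentiable[OF assms(1)])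
  from MVT2[OF assms(2) this] obtain s where s: "0 < s" "s < h"
    "A h - A 0 = h * (partial i u ((x + h *\<^sub>R ?b) + s *\<^sub>R ?a) - partial i u (x + s *\<^sub>R ?a))" by auto
  have "((\<lambda>t. partial i u ((x + s *\<^sub>R ?a) + t *\<^sub>R ?b)) has_real_derivative
      partial j (partial i u) ((x + s *\<^sub>R ?a) + t *\<^sub>R ?b)) (at t)" for t
    by (intro has_real_derivative_axis C2_differentiable[OF assms(1)])
  from MVT2[OF assms(2) this] obtain t where t: "0 < t" "t < h"
    "partial i u ((x + s *\<^sub>R ?a) + h *\<^sub>R ?b) - partial i u (x + s *\<^sub>R ?a)
      = h * partial j (partial i u) ((x + s *\<^sub>R ?a) + t *\<^sub>R ?b)" by auto
  have "A h - A 0 = h\<^sup>2 * partial j (partial i u) (x + s *\<^sub>R ?a + t *\<^sub>R ?b)"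
    using s(3) t(3) by (simp add: add_ac power2_eq_square)
  moreover have "A h - A 0
      = u (x + h *\<^sub>R ?a + h *\<^sub>R ?b) - u (x + h *\<^sub>R ?a) - u (x + h *\<^sub>R ?b) + u x"
    by (simp add: A_def add_ac)
  ultimately show ?thesis using s(1,2) t(1,2) by metis
qed

text \<open>The mixed second difference is symmetric in \<open>i\<close> and \<open>j\<close>, so
  the two mixed derivatives agree at a pair of points near \<open>x\<close>; continuity carries the
  equality to \<open>x\<close>.\<close>

lemma partial_commute:
  fixes u :: "real^'n \<Rightarrow> real"
  assumes "C2 u"
  shows "partial i (partial j u) x = partial j (partial i u) x"
proof (rule ccontr)
  assume ne: "partial i (partial j u) x \<noteq> partial j (partial i u) x"
  define e where "e = \<bar>partial i (partial j u) x - partial j (partial i u) x\<bar> / 2"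
  have e: "e > 0" using ne by (simp add: e_def)
  have "\<exists>d>0. \<forall>y. dist y x < d \<longrightarrow> dist (partial i' (partial j' u) y) (partial i' (partial j' u) x) < e" for i' j'
    using C2_differentiable(3)[OF assms, of i' j'] e
    by (auto simp: continuous_on_iff)
  then obtain d1 d2 where d: "d1 > 0" "d2 > 0"
    and 1: "\<And>y. dist y x < d1 \<Longrightarrow> dist (partial i (partial j u) y) (partial i (partial j u) x) < e"
    and 2: "\<And>y. dist y x < d2 \<Longrightarrow> dist (partial j (partial i u) y) (partial j (partial i u) x) < e"
    by meson
  \<comment> \<open>The evaluation points lie at distance at most \<open>s + t < 2 * h\<close> from
    \<open>x\<close>.\<close>
  define h where "h = min d1 d2 / 2"
  have h: "h > 0" using d by (simp add: h_def)
  obtain s t where st: "0 < s" "s < h" "0 < t" "t < h" and eq: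
    "u (x + h *\<^sub>R axis i 1 + h *\<^sub>R axis j 1) - u (x + h *\<^sub>R axis i 1) - u (x + h *\<^sub>R axis j 1) + u x
      = h\<^sup>2 * partial j (partial i u) (x + s *\<^sub>R axis i 1 + t *\<^sub>R axis j 1)"
    using second_difference[OF assms h, of x i j] by blast
  obtain s' t' where st': "0 < s'" "s' < h" "0 < t'" "t' < h" and eq':
    "u (x + h *\<^sub>R axis j 1 + h *\<^sub>R axis i 1) - u (x + h *\<^sub>R axis j 1) - u (x + h *\<^sub>R axis i 1) + u x
      = h\<^sup>2 * partial i (partial j u) (x + s' *\<^sub>R axis j 1 + t' *\<^sub>R axis i 1)"
    using second_difference[OF assms h, of x j i] by blast
  have near: "dist (x + s *\<^sub>R axis k 1 + t *\<^sub>R axis l 1) x < min d1 d2"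
    if "0 < s" "s < h" "0 < t" "t < h" for s t k l
  proof -
    have "norm (s *\<^sub>R axis k 1 + t *\<^sub>R axis l 1 :: real^'n) \<le> s + t"
      using that norm_triangle_ineq[of "s *\<^sub>R axis k 1" "t *\<^sub>R axis l 1 :: real^'n"] by (simp add: norm_axis_1)
    also have "\<dots> < min d1 d2" using that by (simp add: h_def)
    finally show ?thesis by (simp add: dist_norm add.assoc)
  qed
  have "u (x + h *\<^sub>R axis j 1 + h *\<^sub>R axis i 1) = u (x + h *\<^sub>R axis i 1 + h *\<^sub>R axis j 1)"
    by (simp add: add_ac)
  with eq eq' have "h\<^sup>2 * partial j (partial i u) (x + s *\<^sub>R axis i 1 + t *\<^sub>R axis j 1)
    = h\<^sup>2 * partial i (partial j u) (x + s' *\<^sub>R axis j 1 + t' *\<^sub>R axis i 1)" by linarith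
  then have "partial j (partial i u) (x + s *\<^sub>R axis i 1 + t *\<^sub>R axis j 1)
    = partial i (partial j u) (x + s' *\<^sub>R axis j 1 + t' *\<^sub>R axis i 1)" using h by simp
  moreover have "dist (partial j (partial i u) (x + s *\<^sub>R axis i 1 + t *\<^sub>R axis j 1)) (partial j (partial i u) x) < e"
    using near[OF st, of i j] by (intro 2) simp
  moreover have "dist (partial i (partial j u) (x + s' *\<^sub>R axis j 1 + t' *\<^sub>R axis i 1)) (partial i (partial j u) x) < e"
    using near[OF st', of j i] by (intro 1) simp
  ultimately have "\<bar>partial i (partial j u) x - partial j (partial i u) x\<bar> < 2 * e"
    by (simp add: dist_real_def)
  then show False by (simp add: e_def)
qed

text \<open>If \<open>c < 0\<close>, then \<open>k'\<close>, which vanishes at 0, would be negative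
  just to the right, and the mean value theorem would push \<open>k\<close> below
  \<open>k 0\<close>.\<close>

lemma second_derivative_at_local_min:
  fixes k :: "real \<Rightarrow> real"
  assumes k: "\<forall>\<^sub>F t in nhds 0. (k has_real_derivative k' t) (at t)"
    and k': "(k' has_real_derivative c) (at 0)" and min: "\<forall>\<^sub>F t in nhds 0. k 0 \<le> k t"
  shows "c \<ge> 0"
proof (rule ccontr)
  assume "\<not> c \<ge> 0"
  obtain d1 where d1: "d1 > 0" "\<And>t. \<bar>t\<bar> < d1 \<Longrightarrow> (k has_real_derivative k' t) (at t)"
    using k by (auto simp: eventually_nhds_metric dist_real_def)
  obtain d2 where d2: "d2 > 0" "\<And>t. \<bar>t\<bar> < d2 \<Longrightarrow> k 0 \<le> k t"
    using min by (auto simp: eventually_nhds_metric dist_real_def)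
  have "k' 0 = 0"
    using DERIV_local_min[OF d1(2)[of 0] d2(1)] d1(1) d2(2) by simp
  obtain d3 where d3: "d3 > 0" "\<And>t. 0 < t \<Longrightarrow> t < d3 \<Longrightarrow> k' 0 > k' t"
    using has_real_derivative_neg_dec_right[OF k'] \<open>\<not> c \<ge> 0\<close> by auto
  define h where "h = min d1 (min d2 d3) / 2"
  have h: "0 < h" "h < d1" "h < d2" "h < d3" using d1(1) d2(1) d3(1) by (auto simp: h_def)
  obtain t where t: "0 < t" "t < h" "k h - k 0 = (h - 0) * k' t"
    using MVT2[of 0 h k k'] h d1(2) by auto
  have "k' t < 0" using d3(2)[of t] t h \<open>k' 0 = 0\<close> by simp
  then have "h * k' t < 0" using h by (simp add: mult_pos_neg)
  moreover have "k 0 \<le> k h" using d2(2)[of h] h by simp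
  ultimately show False using t(3) by simp
qed

section \<open>Hessian inequalities at contact points\<close>

lemma has_real_derivative_grad_line:
  fixes u :: "real^'n \<Rightarrow> real"
  assumes "C2 u"
  shows "((\<lambda>t. grad u (x + t *\<^sub>R \<xi>) \<bullet> \<xi>) has_real_derivative \<xi> \<bullet> (hessian u x *v \<xi>)) (at 0)"
proof -
  have "((\<lambda>t. \<Sum>i\<in>UNIV. partial i u (x + t *\<^sub>R \<xi>) * \<xi> $ i) has_real_derivative
      (\<Sum>i\<in>UNIV. (grad (partial i u) (x + 0 *\<^sub>R \<xi>) \<bullet> \<xi>) * \<xi> $ i)) (at 0)"
    by (intro DERIV_sum DERIV_cmult_right has_real_derivative_line C2_differentiable[OF assms])
  moreover have "(\<lambda>t. \<Sum>i\<in>UNIV. partial i u (x + t *\<^sub>R \<xi>) * \<xi> $ i) = (\<lambda>t. grad u (x + t *\<^sub>R \<xi>) \<bullet> \<xi>)"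
    by (simp add: grad_def inner_vec_def)
  moreover have "(\<Sum>i\<in>UNIV. (grad (partial i u) (x + 0 *\<^sub>R \<xi>) \<bullet> \<xi>) * \<xi> $ i) = \<xi> \<bullet> (hessian u x *v \<xi>)"
    by (simp add: grad_def inner_vec_def hessian_def matrix_vector_mult_def sum_distrib_left sum_distrib_right
        partial_commute[OF assms] mult_ac)
  ultimately show ?thesis by simp
qed

lemma tensor_square_quadratic_form: "\<xi> \<bullet> (tensor_square \<eta> *v \<xi>) = (\<eta> \<bullet> \<xi>)\<^sup>2"
  by (simp add: tensor_square_def inner_vec_def matrix_vector_mult_def power2_eq_square
      sum_product sum_distrib_left mult_ac)

text \<open>The change of unknown \<open>v = \<Phi> (u)\<close> absorbs the gradient term:
  \<open>D\<^sup>2v = e\<^sup>G (D\<^sup>2u + g(u) \<nabla>u \<otimes> \<nabla>u)\<close>.\<close>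

lemma touches_below_hessian:
  fixes u :: "real^'n \<Rightarrow> real"
  assumes "C2 u" and G: "\<And>t. (G has_real_derivative g t) (at t)"
    and \<Phi>: "\<And>t. (\<Phi> has_real_derivative exp (G t)) (at t)"
    and touch: "touches_below (\<lambda>x. \<Phi> (u x)) x0 z a b"
  shows "exp (G (u z)) * (\<xi> \<bullet> ((hessian u z + g (u z) *\<^sub>R tensor_square (grad u z)) *v \<xi>))
    \<ge> a * (\<xi> \<bullet> \<xi>) + b * ((z - x0) \<bullet> \<xi>)\<^sup>2"
proof -
  obtain \<phi> \<phi>' where \<phi>: "\<forall>\<^sub>F s in nhds ((norm (z - x0))\<^sup>2). (\<phi> has_real_derivative \<phi>' s) (at s)"
    and a: "a = 2 * \<phi>' ((norm (z - x0))\<^sup>2)"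
    and \<phi>': "(\<phi>' has_real_derivative b / 4) (at ((norm (z - x0))\<^sup>2))"
    and min: "\<forall>\<^sub>F y in nhds z. \<Phi> (u z) - \<phi> ((norm (z - x0))\<^sup>2) \<le> \<Phi> (u y) - \<phi> ((norm (y - x0))\<^sup>2)"
    using touch unfolding touches_below_def by blast
  define n where "n t = (norm (z - x0))\<^sup>2 + 2 * t * ((z - x0) \<bullet> \<xi>) + t\<^sup>2 * (\<xi> \<bullet> \<xi>)" for t
  have n: "(norm (z + t *\<^sub>R \<xi> - x0))\<^sup>2 = n t" for t
    unfolding n_def dot_square_norm[symmetric]
    by (simp add: inner_simps power2_eq_square inner_commute algebra_simps)
  have n0: "n 0 = (norm (z - x0))\<^sup>2" by (simp add: n_def)
  have n': "(n has_real_derivative 2 * ((z - x0) \<bullet> \<xi>) + 2 * t * (\<xi> \<bullet> \<xi>)) (at t)" for t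
    unfolding n_def by (auto intro!: derivative_eq_intros)
  have tendsto_line: "((\<lambda>t. z + t *\<^sub>R \<xi>) \<longlongrightarrow> z) (nhds 0)"
    using tendsto_at_iff_tendsto_nhds[of "\<lambda>t. z + t *\<^sub>R \<xi>" 0]
    by (auto intro!: tendsto_eq_intros)
  have tendsto_n: "(n \<longlongrightarrow> (norm (z - x0))\<^sup>2) (nhds 0)"
    using tendsto_at_iff_tendsto_nhds[of n 0] n' n0 by (metis DERIV_isCont isCont_def)
  define U where "U t = u (z + t *\<^sub>R \<xi>)" for t
  define U' where "U' t = grad u (z + t *\<^sub>R \<xi>) \<bullet> \<xi>" for t
  have U: "(U has_real_derivative U' t) (at t)" for t
    unfolding U_def U'_def by (intro has_real_derivative_line C2_differentiable[OF assms(1)])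
  have U': "(U' has_real_derivative \<xi> \<bullet> (hessian u z *v \<xi>)) (at 0)"
    unfolding U'_def by (rule has_real_derivative_grad_line[OF assms(1)])
  \<comment> \<open>The difference of solution and test function along the line through
    \<open>z\<close> in direction \<xi> has a local minimum at 0. Differentiating the exponential
    factor in \<open>k'\<close> produces the term with \<open>g\<close>.\<close>
  define k where "k t = \<Phi> (U t) - \<phi> (n t)" for t
  define k' where "k' t = exp (G (U t)) * U' t - \<phi>' (n t) * (2 * ((z - x0) \<bullet> \<xi>) + 2 * t * (\<xi> \<bullet> \<xi>))" for t
  have "\<forall>\<^sub>F t in nhds 0. (\<phi> has_real_derivative \<phi>' (n t)) (at (n t))"
    using filterlim_iff[THEN iffD1, OF tendsto_n] \<phi> by blast
  then have "\<forall>\<^sub>F t in nhds 0. (k has_real_derivative k' t) (at t)"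
    unfolding k_def k'_def
    by eventually_elim (intro DERIV_diff DERIV_chain2[OF \<Phi> U] DERIV_chain2[OF _ n'])
  moreover have "(k' has_real_derivative
      exp (G (U 0)) * (g (U 0) * U' 0) * U' 0 + exp (G (U 0)) * (\<xi> \<bullet> (hessian u z *v \<xi>))
      - (b / 4 * (2 * ((z - x0) \<bullet> \<xi>)) * (2 * ((z - x0) \<bullet> \<xi>)) + \<phi>' (n 0) * (2 * (\<xi> \<bullet> \<xi>)))) (at 0)"
  proof -
    have A: "((\<lambda>t. exp (G (U t))) has_real_derivative exp (G (U 0)) * (g (U 0) * U' 0)) (at 0)"
      by (intro DERIV_chain2[OF DERIV_exp] DERIV_chain2[OF G U])
    have B: "((\<lambda>t. \<phi>' (n t)) has_real_derivative b / 4 * (2 * ((z - x0) \<bullet> \<xi>))) (at 0)"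
      using DERIV_chain2[of \<phi>' "b / 4" n 0, OF _ n'[of 0]] \<phi>' by (simp add: n0)
    have C: "((\<lambda>t. 2 * ((z - x0) \<bullet> \<xi>) + 2 * t * (\<xi> \<bullet> \<xi>)) has_real_derivative 2 * (\<xi> \<bullet> \<xi>)) (at 0)"
      by (auto intro!: derivative_eq_intros)
    show ?thesis
      unfolding k'_def
      by (rule DERIV_cong[OF DERIV_diff[OF DERIV_mult[OF A U'] DERIV_mult[OF B C]]])
        (simp add: algebra_simps)
  qed
  moreover have "\<forall>\<^sub>F t in nhds 0. k 0 \<le> k t"
  proof -
    have "\<forall>\<^sub>F t in nhds 0. \<Phi> (u z) - \<phi> ((norm (z - x0))\<^sup>2)
        \<le> \<Phi> (u (z + t *\<^sub>R \<xi>)) - \<phi> ((norm (z + t *\<^sub>R \<xi> - x0))\<^sup>2)"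
      using filterlim_iff[THEN iffD1, OF tendsto_line] min by blast
    then show ?thesis by (simp add: k_def U_def n n0)
  qed
  ultimately have "0 \<le> exp (G (U 0)) * (g (U 0) * U' 0) * U' 0 + exp (G (U 0)) * (\<xi> \<bullet> (hessian u z *v \<xi>))
      - (b / 4 * (2 * ((z - x0) \<bullet> \<xi>)) * (2 * ((z - x0) \<bullet> \<xi>)) + \<phi>' (n 0) * (2 * (\<xi> \<bullet> \<xi>)))"
    by (rule second_derivative_at_local_min)
  moreover have "\<xi> \<bullet> ((hessian u z + g (u z) *\<^sub>R tensor_square (grad u z)) *v \<xi>)
      = \<xi> \<bullet> (hessian u z *v \<xi>) + g (u z) * (grad u z \<bullet> \<xi>)\<^sup>2"
    by (simp add: matrix_vector_mult_add_rdistrib inner_add_right scaleR_matrix_vector_assoc[symmetric]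
        tensor_square_quadratic_form)
  ultimately show ?thesis
    by (simp add: U_def U'_def n0 a power2_eq_square algebra_simps)
qed

text \<open>For negative \<open>t\<close> the interval \<open>{0..t}\<close> is empty and the
  integral is 0, so it need not be differentiable at 0. \<open>H\<close> is an antiderivative on the
  whole line that agrees with the integral for \<open>t \<ge> 0\<close>.\<close>

lemma antiderivative_on_reals:
  fixes h :: "real \<Rightarrow> real"
  assumes "continuous_on UNIV h"
  obtains H where "\<And>t. (H has_real_derivative h t) (at t)" "H 0 = 0"
    "\<And>t. t \<ge> 0 \<Longrightarrow> integral {0..t} h = H t"
proof -
  obtain F where F: "\<And>t. (F has_vector_derivative h t) (at t)"
    using einterval_antiderivative[of "-\<infinity>" \<infinity> h] assms by (auto simp: continuous_on_eq_continuous_at)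
  define H where "H t = F t - F 0" for t
  have H: "(H has_real_derivative h t) (at t)" for t
    using F[of t] unfolding H_def has_real_derivative_iff_has_vector_derivative
    by (auto intro!: derivative_eq_intros)
  have "H 0 = 0" by (simp add: H_def)
  have int: "integral {0..t} h = H t" if "t \<ge> 0" for t
  proof -
    have "(h has_integral H t - H 0) {0..t}"
      using that H by (intro fundamental_theorem_of_calculus)
        (auto simp: has_real_derivative_iff_has_vector_derivative intro: has_vector_derivative_at_within)
    then show ?thesis using \<open>H 0 = 0\<close> by (simp add: integral_unique)
  qed
  from H \<open>H 0 = 0\<close> int show ?thesis by (rule that)
qed

text \<open>The common core for both operators: \<open>F\<close> enters only through a sharp radial
  lower bound, which encodes the effective dimension \<open>2 * \<beta> + 2\<close>, and a coarse
  one. They make the transformed solution an instance of the locale.\<close>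

lemma classical_solution_supercritical:
  fixes F :: "real^'n^'n \<Rightarrow> real"
  assumes sol: "classical_solution F g (nonlinearity g p) u" and u: "u x0 \<noteq> 0"
    and g: "continuous_on {0..} g"
    and params: "\<beta> > 0" "\<mu> > 0" "K > 0" "p > 1"
    and F_radial: "\<And>M a b x. transpose M = M \<Longrightarrow>
      (\<And>\<xi>. \<xi> \<bullet> (M *v \<xi>) \<ge> a * (\<xi> \<bullet> \<xi>) + b * (x \<bullet> \<xi>)\<^sup>2) \<Longrightarrow> x \<noteq> 0 \<Longrightarrow> a \<le> 0 \<Longrightarrow>
      a + b * (x \<bullet> x) \<ge> 0 \<Longrightarrow> F M \<ge> \<mu> * (a + b * (x \<bullet> x)) + \<mu> * (2 * \<beta> + 1) * a"
    and F_ge: "\<And>M a. transpose M = M \<Longrightarrow> (\<And>\<xi>. \<xi> \<bullet> (M *v \<xi>) \<ge> a * (\<xi> \<bullet> \<xi>)) \<Longrightarrow> a \<le> 0 \<Longrightarrow> F M \<ge> K * a"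
  shows "\<beta> * p > \<beta> + 1"
proof -
  have C2: "C2 u" and nonneg: "\<And>x. u x \<ge> 0"
    and eq: "\<And>x. F (hessian u x + g (u x) *\<^sub>R tensor_square (grad u x)) = - nonlinearity g p (u x)"
    using sol by (auto simp: classical_solution_def eq_neg_iff_add_eq_0)
  \<comment> \<open>Continuing \<open>g\<close> by the constant \<open>g 0\<close> makes the
    antiderivatives differentiable on the whole line, in particular where \<open>u\<close>
    vanishes.\<close>
  define g' where "g' t = g (max 0 t)" for t
  have g': "g' t = g t" if "t \<ge> 0" for t using that by (simp add: g'_def)
  have "continuous_on UNIV g'"
    unfolding g'_def by (rule continuous_on_compose2[OF g]) (auto intro!: continuous_intros)
  then obtain G where G: "\<And>t. (G has_real_derivative g' t) (at t)"
    and G_int: "\<And>t. t \<ge> 0 \<Longrightarrow> integral {0..t} g' = G t"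
    using antiderivative_on_reals by metis
  have primitive: "primitive g t = G t" if "t \<ge> 0" for t
  proof -
    have "integral {0..t} g = integral {0..t} g'"
      by (intro integral_cong) (simp add: g')
    then show ?thesis using G_int[OF that] by (simp add: primitive_def)
  qed
  have "continuous_on UNIV (\<lambda>t. exp (G t))"
    using G by (intro continuous_intros continuous_at_imp_continuous_on ballI) (auto intro: DERIV_isCont)
  then obtain \<Phi> where \<Phi>: "\<And>t. (\<Phi> has_real_derivative exp (G t)) (at t)" "\<Phi> 0 = 0"
    and \<Phi>_int: "\<And>t. t \<ge> 0 \<Longrightarrow> integral {0..t} (\<lambda>t. exp (G t)) = \<Phi> t"
    using antiderivative_on_reals by metis
  have phi: "phi g t = \<Phi> t" if "t \<ge> 0" for t
  proof -
    have "integral {0..t} (\<lambda>t. exp (primitive g t)) = integral {0..t} (\<lambda>t. exp (G t))"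
      by (intro integral_cong) (simp add: primitive)
    then show ?thesis using \<Phi>_int[OF that] by (simp add: phi_def)
  qed
  have \<Phi>_pos: "\<Phi> t > 0" if "t > 0" for t
    using DERIV_pos_imp_increasing[OF that, of \<Phi>] \<Phi> exp_gt_zero by metis
  have \<Phi>_nonneg: "\<Phi> (u x) \<ge> 0" for x
    using nonneg[of x] \<Phi>_pos[of "u x"] \<Phi>(2) by (cases "u x = 0") auto
  define M where "M x = hessian u x + g' (u x) *\<^sub>R tensor_square (grad u x)" for x
  have FM: "F (M x) = - (\<Phi> (u x) powr p) * exp (- G (u x))" for x
    using eq[of x] nonneg[of x] by (simp add: M_def g' nonlinearity_def phi primitive)
  have sym: "transpose (M x) = M x" for x
    by (simp add: M_def vec_eq_iff transpose_def hessian_def tensor_square_def partial_commute[OF C2] mult.commute)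
  interpret radial_supersolution "\<lambda>x. \<Phi> (u x)" x0 \<beta> "1 / \<mu>" K p
  proof
    show "continuous_on UNIV (\<lambda>x. \<Phi> (u x))"
    proof (rule continuous_on_compose2[of UNIV \<Phi> UNIV u])
      show "continuous_on UNIV \<Phi>"
        using \<Phi>(1) by (intro continuous_at_imp_continuous_on ballI) (auto intro: DERIV_isCont)
      show "continuous_on UNIV u"
        using C2_differentiable(1)[OF C2]
        by (intro continuous_at_imp_continuous_on ballI differentiable_imp_continuous_within)
    qed auto
    show "\<Phi> (u x0) > 0" using \<Phi>_pos[of "u x0"] nonneg[of x0] u by simp
    fix z a b
    \<comment> \<open>\<open>E\<close> converts Hessian bounds for the transformed solution into
      bounds for \<open>M z\<close>. The lower bounds on \<open>F\<close> are linear in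
      \<open>a\<close> and \<open>b\<close>, so \<open>E\<close> cancels against the exponential
      factor of the nonlinearity.\<close>
    define E where "E = exp (- G (u z))"
    have E: "E > 0" "exp (G (u z)) * E = 1" by (simp_all add: E_def flip: exp_add)
    assume touch: "touches_below (\<lambda>x. \<Phi> (u x)) x0 z a b" and a: "a \<le> 0"
    have M: "\<xi> \<bullet> (M z *v \<xi>) \<ge> (E * a) * (\<xi> \<bullet> \<xi>) + (E * b) * ((z - x0) \<bullet> \<xi>)\<^sup>2" for \<xi>
    proof -
      have "E * (exp (G (u z)) * (\<xi> \<bullet> (M z *v \<xi>))) \<ge> E * (a * (\<xi> \<bullet> \<xi>) + b * ((z - x0) \<bullet> \<xi>)\<^sup>2)"
        unfolding M_def using E(1)
        by (intro mult_left_mono touches_below_hessian[OF C2 G \<Phi>(1) touch]) auto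
      moreover have "E * (exp (G (u z)) * (\<xi> \<bullet> (M z *v \<xi>))) = \<xi> \<bullet> (M z *v \<xi>)"
        using E(2) by (simp add: mult.assoc[symmetric] mult.commute)
      ultimately show ?thesis by (simp add: algebra_simps)
    qed
    have Ea: "E * a \<le> 0" using E a by (simp add: mult_nonneg_nonpos)
    have FMz: "F (M z) = E * - (\<Phi> (u z) powr p)" by (simp add: FM E_def)
    {
      assume "z \<noteq> x0" and ab: "a + b * (norm (z - x0))\<^sup>2 \<ge> 0"
      have "E * (a + b * (norm (z - x0))\<^sup>2) \<ge> 0" using ab E by simp
      then have "\<mu> * (E * a + E * b * ((z - x0) \<bullet> (z - x0))) + \<mu> * (2 * \<beta> + 1) * (E * a) \<le> F (M z)"
        using \<open>z \<noteq> x0\<close> by (intro F_radial[OF sym M _ Ea]) (auto simp: dot_square_norm algebra_simps)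
      then have "E * (\<mu> * ((a + b * (norm (z - x0))\<^sup>2) + (2 * \<beta> + 1) * a)) \<le> E * - (\<Phi> (u z) powr p)"
        unfolding FMz by (simp add: dot_square_norm algebra_simps)
      then have "\<mu> * ((a + b * (norm (z - x0))\<^sup>2) + (2 * \<beta> + 1) * a) \<le> - (\<Phi> (u z) powr p)"
        using E(1) mult_le_cancel_left_pos by blast
      then show "(a + b * (norm (z - x0))\<^sup>2) + (2 * \<beta> + 1) * a \<le> - (1 / \<mu>) * \<Phi> (u z) powr p"
        using params divide_right_mono[of "\<mu> * ((a + b * (norm (z - x0))\<^sup>2) + (2 * \<beta> + 1) * a)" _ \<mu>]
        by force
    next
      assume "b \<ge> 0"
      then have "E * b * ((z - x0) \<bullet> \<xi>)\<^sup>2 \<ge> 0" for \<xi> using E by simp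
      then have "\<xi> \<bullet> (M z *v \<xi>) \<ge> (E * a) * (\<xi> \<bullet> \<xi>)" for \<xi> using M[of \<xi>] by (smt (verit))
      then have "K * (E * a) \<le> F (M z)" by (intro F_ge sym Ea)
      then have "E * (K * a) \<le> E * - (\<Phi> (u z) powr p)" unfolding FMz by (simp only: mult_ac)
      then show "K * a \<le> - (\<Phi> (u z) powr p)" using E(1) mult_le_cancel_left_pos by blast
    }
  qed (use params \<Phi>_nonneg in auto)
  show ?thesis by (rule supercritical)
qed

section \<open>Critical exponents of the two Pucci operators\<close>

theorem theorem1p6:
  fixes lam Lam p :: real and g :: "real \<Rightarrow> real"
  assumes "CARD('n::finite) \<ge> 3"
    and "0 < lam" and "lam \<le> Lam"
    and "continuous_on {0..} g" and "\<And>t. t \<ge> 0 \<Longrightarrow> g t \<ge> 0"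
    and "p > 1"
  shows
    "(dim_plus lam Lam CARD('n) > 2 \<and>
      p \<le> dim_plus lam Lam CARD('n) / (dim_plus lam Lam CARD('n) - 2) \<longrightarrow>
        \<not> (\<exists>u :: real^'n \<Rightarrow> real.
              classical_solution (pucci_plus lam Lam) g (nonlinearity g p) u \<and> u \<noteq> (\<lambda>_. 0)))
     \<and>
     (p \<le> dim_minus lam Lam CARD('n) / (dim_minus lam Lam CARD('n) - 2) \<longrightarrow>
        \<not> (\<exists>u :: real^'n \<Rightarrow> real.
              classical_solution (pucci_minus lam Lam) g (nonlinearity g p) u \<and> u \<noteq> (\<lambda>_. 0)))"
proof -
  have Lam: "Lam > 0" using assms by linarith
  have n: "real CARD('n) \<ge> 3" using assms(1) by simp
  have K: "Lam * real CARD('n) > 0" using Lam n by simp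
  \<comment> \<open>With \<open>\<beta> = (D - 2) / 2\<close> the bound on \<open>p\<close> reads
    \<open>\<beta> * p \<le> \<beta> + 1\<close>, the negation of what a non-trivial solution
    forces.\<close>
  have crit: "(D - 2) / 2 * p \<le> (D - 2) / 2 + 1" if "D > 2" "p \<le> D / (D - 2)" for D
    using that by (simp add: pos_le_divide_eq field_simps)
  have plus: False if D: "dim_plus lam Lam CARD('n) > 2"
    "p \<le> dim_plus lam Lam CARD('n) / (dim_plus lam Lam CARD('n) - 2)"
    and u: "classical_solution (pucci_plus lam Lam) g (nonlinearity g p) u" "u x0 \<noteq> 0"
    for u :: "real^'n \<Rightarrow> real" and x0
  proof -
    define \<beta> where "\<beta> = (dim_plus lam Lam CARD('n) - 2) / 2"
    have \<beta>: "\<beta> > 0" using D by (simp add: \<beta>_def)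
    \<comment> \<open>The effective dimension minus 1 is \<open>2 * \<beta> + 1\<close>; this
      matches the tangential coefficient in \<open>pucci_plus_ge\<close>.\<close>
    have \<mu>: "Lam * (2 * \<beta> + 1) = lam * (real CARD('n) - 1)"
      using Lam by (simp add: \<beta>_def dim_plus_def field_simps)
    have "\<beta> * p > \<beta> + 1"
    proof (rule classical_solution_supercritical[OF u assms(4) \<beta> Lam K assms(6)])
      fix M :: "real^'n^'n" and a b x
      assume "transpose M = M" "\<And>\<xi>. \<xi> \<bullet> (M *v \<xi>) \<ge> a * (\<xi> \<bullet> \<xi>) + b * (x \<bullet> \<xi>)\<^sup>2" "x \<noteq> 0"
        "a \<le> 0" "a + b * (x \<bullet> x) \<ge> 0"
      then show "pucci_plus lam Lam M \<ge> Lam * (a + b * (x \<bullet> x)) + Lam * (2 * \<beta> + 1) * a"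
        unfolding \<mu> using assms(2,3) by (intro pucci_plus_ge)
    qed (rule pucci_ge_dim(1)[OF _ assms(2,3)])
    with crit[OF D] show False by (simp add: \<beta>_def)
  qed
  have minus: False if D: "p \<le> dim_minus lam Lam CARD('n) / (dim_minus lam Lam CARD('n) - 2)"
    and u: "classical_solution (pucci_minus lam Lam) g (nonlinearity g p) u" "u x0 \<noteq> 0"
    for u :: "real^'n \<Rightarrow> real" and x0
  proof -
    define \<beta> where "\<beta> = (dim_minus lam Lam CARD('n) - 2) / 2"
    \<comment> \<open>Here the effective dimension exceeds 2 automatically, since
      \<open>Lam / lam \<ge> 1\<close> and the space has dimension at least 3.\<close>
    have "Lam / lam * (real CARD('n) - 1) \<ge> 1 * 2"
      using assms n by (intro mult_mono) auto
    then have D2: "dim_minus lam Lam CARD('n) > 2" by (simp add: dim_minus_def)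
    then have \<beta>: "\<beta> > 0" by (simp add: \<beta>_def)
    have \<mu>: "lam * (2 * \<beta> + 1) = Lam * (real CARD('n) - 1)"
      using assms(2) by (simp add: \<beta>_def dim_minus_def field_simps)
    have "\<beta> * p > \<beta> + 1"
    proof (rule classical_solution_supercritical[OF u assms(4) \<beta> assms(2) K assms(6)])
      fix M :: "real^'n^'n" and a b x
      assume "transpose M = M" "\<And>\<xi>. \<xi> \<bullet> (M *v \<xi>) \<ge> a * (\<xi> \<bullet> \<xi>) + b * (x \<bullet> \<xi>)\<^sup>2" "x \<noteq> 0"
        "a \<le> 0" "a + b * (x \<bullet> x) \<ge> 0"
      then show "pucci_minus lam Lam M \<ge> lam * (a + b * (x \<bullet> x)) + lam * (2 * \<beta> + 1) * a"
        unfolding \<mu> using assms(2,3) by (intro pucci_minus_ge)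
    qed (rule pucci_ge_dim(2)[OF _ assms(2,3)])
    with crit[OF D2 D] show False by (simp add: \<beta>_def)
  qed
  have "\<exists>x0. u x0 \<noteq> 0" if "u \<noteq> (\<lambda>_. 0)" for u :: "real^'n \<Rightarrow> real" using that by auto
  with plus minus show ?thesis by blast
qed

end
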